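(* Let $\Sigma_{\mathsf{zkLogin}}=(\mathsf{Gen},\mathsf{Sign},\mathsf{Verify})$ be the Tagged Witness Signature scheme for the predicate $P_{\mathsf{zkLogin}}$ described in the context, built from a NIZK scheme $\Pi$ for the relation $\mathsf{Ckt}$. If $\Pi$ satisfies zero-knowledge, then $\Sigma_{\mathsf{zkLogin}}$ achieves witness hiding: for all PPT adversaries $\mathcal{A}$ there exist simulators $(\mathsf{SimGen},\mathsf{SimSign})$ such that $$\left|\Pr[\textbf{Expt-Real}_{\mathcal{A}}(1^\lambda)=1]-\Pr[\textbf{Expt-Sim}_{\mathcal{A}}(1^\lambda)=1]\right|\le\mathsf{negl}(\lambda).$$
   Context: **Tagged Witness Signature (TWS).** For a predicate $P:\{0,1\}^*\times\{0,1\}^*\to\{0,1\}$ (inputs: public tag $t$, secret witness $w$), a TWS is a triple $(\mathsf{Gen},\mathsf{Sign},\mathsf{Verify})$ with $\mathsf{Gen}(1^\lambda)\to pk$, $\mathsf{Sign}(t,pk,w,m)\to\sigma$, $\mathsf{Verify}(t,pk,m,\sigma)\to 0/1$. **Witness-hiding experiments.** - $\textbf{Expt-Real}_{\mathcal{A}}(1^\lambda)$: $pk\gets\mathsf{Gen}(1^\lambda)$; $b\gets\mathcal{A}^{\mathcal{O}^{\mathsf{Sign}}(\cdot,\cdot)}(pk)$; return $b$. Here $\mathcal{O}^{\mathsf{Sign}}(t,m)$ obtains $w$ with $P(t,w)=1$ and returns $\sigma\gets\mathsf{Sign}(t,pk,w,m)$. - $\textbf{Expt-Sim}_{\mathcal{A}}(1^\lambda)$: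 $(pk,\mathsf{trap})\gets\mathsf{SimGen}(1^\lambda)$; $b\gets\mathcal{A}^{\mathcal{O}^{\mathsf{SimSign}}(\cdot,\cdot)}(pk)$; return $b$. Here $\mathcal{O}^{\mathsf{SimSign}}(t,m)$ returns $\sigma\gets\mathsf{SimSign}(t,pk,\mathsf{trap},m)$. **JWTs.** An OpenID Provider (OP), identified by an issuer string $\mathsf{iss}$, is trusted and holds a fixed signing key pair $(sk_{OP},pk_{OP})$. $JWT.\mathsf{Issue}(sk_{OP},\mathcal{C})\to\mathsf{jwt}$ signs a claim set $\mathcal{C}=\{\mathsf{stid},\mathsf{aud},\mathsf{iss},\mathsf{nonce},\dots\}$ (stable user identifier, application identifier, issuer, nonce), and $JWT.\mathsf{Verify}(pk_{OP},\mathsf{jwt})\in\{0,1\}$ checks the signature. $\mathsf{jwt}.x$ denotes the value of claim $x$. $H$ is a hash function and $Sig$ a signature scheme. In every tag, $pk_{OP}$ is the correct public key of the issuer $\mathsf{iss}$. **Predicate $P_{\mathsf{zkLogin}}$.** For $t=\mathsf{tag}=(pk_{OP},\mathsf{iss},\mathsf{zkaddr},T)$ and $w=(\mathsf{jwt},\mathsf{salt},r,vk_u,sk_u)$, $P_{\mathsf{zkLogin}}(t,w)=1$ iff: $\mathsf{zkaddr}=H(\mathsf{jwt}.\mathsf{stid},\mathsf{jwt}.\mathsf{aud},\mathsf{jwt}.\mathsf{iss},\mathsf{salt})$; $\mathsf{jwt}.\mathsf{iss}=\mathsf{iss}$; $\mathsf{jwt}.\mathsf{nonce}=H(vk_u,T,r)$;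 $JWT.\mathsf{Verify}(pk_{OP},\mathsf{jwt})=1$; and $(sk_u,vk_u)$ is a valid key pair of $Sig$. **Relation $\mathsf{Ckt}$.** For statement $\mathsf{zkx}=(pk_{OP},\mathsf{iss},\mathsf{zkaddr},T,vk_u)$ and witness $\mathsf{zkw}=(\mathsf{jwt},\mathsf{salt},r)$, $\mathsf{Ckt}(\mathsf{zkx},\mathsf{zkw})$ holds iff: $\mathsf{zkaddr}=H(\mathsf{jwt}.\mathsf{stid},\mathsf{jwt}.\mathsf{aud},\mathsf{jwt}.\mathsf{iss},\mathsf{salt})$; $\mathsf{jwt}.\mathsf{iss}=\mathsf{iss}$; $\mathsf{jwt}.\mathsf{nonce}=H(vk_u,T,r)$; and $JWT.\mathsf{Verify}(pk_{OP},\mathsf{jwt})=1$ (validity of a key pair of $Sig$ is not part of this relation). **Scheme $\Sigma_{\mathsf{zkLogin}}$.** Let $\Pi=(\mathsf{Gen},\mathsf{Prove},\mathsf{Verify})$ be a NIZK scheme in the CRS model. - $\mathsf{Gen}(1^\lambda)$: output $pk=zkcrs\gets\Pi.\mathsf{Gen}(1^\lambda,\mathsf{Ckt})$. - $\mathsf{Sign}(\mathsf{tag},pk,w,M)$: parse $\mathsf{tag}=(pk_{OP},\mathsf{iss},\mathsf{zkaddr},T)$, $pk=zkcrs$, $w=(\mathsf{jwt},\mathsf{salt},r,vk_u,sk_u)$; set $\sigma_u\gets Sig.\mathsf{Sign}(sk_u,M)$, $\mathsf{zkx}\gets(pk_{OP},\mathsf{iss},\mathsf{zkaddr},T,vk_u)$,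 $\mathsf{zkw}\gets(\mathsf{jwt},\mathsf{salt},r)$, $\pi\gets\Pi.\mathsf{Prove}(zkcrs,\mathsf{zkx},\mathsf{zkw})$; output $\sigma=(vk_u,T,\sigma_u,\pi)$. - $\mathsf{Verify}(\mathsf{tag},pk,M,\sigma)$: parse $\mathsf{tag}=(pk_{OP},\mathsf{iss},\mathsf{zkaddr},T)$ and $\sigma=(vk_u,T,\sigma_u,\pi)$ (same $T$); set $\mathsf{zkx}\gets(pk_{OP},\mathsf{iss},\mathsf{zkaddr},T,vk_u)$; accept iff $\sigma_u$ verifies under $Sig$ with key $vk_u$ on $M$, and $\Pi.\mathsf{Verify}(zkcrs,\mathsf{zkx},\pi)=1$. **How witnesses are obtained.** For a tag $(pk_{OP},\mathsf{iss},\mathsf{zkaddr},T)$, "obtain $w$" means: sample a fresh $(vk_u,sk_u)\gets Sig.\mathsf{Gen}(1^\lambda)$ and $r\gets\{0,1\}^\lambda$; set $\mathsf{nonce}\gets H(vk_u,T,r)$; obtain from the user/app owning $\mathsf{zkaddr}$ the values $\mathsf{stid},\mathsf{aud},\mathsf{salt}$ (with $\mathsf{zkaddr}=H(\mathsf{stid},\mathsf{aud},\mathsf{iss},\mathsf{salt})$); obtain $\mathsf{jwt}\gets JWT.\mathsf{Issue}(sk_{OP},\{\mathsf{stid},\mathsf{aud},\mathsf{iss},\mathsf{nonce}\})$ from the OP; $w=(\mathsf{jwt},\mathsf{salt},r,vk_u,sk_u)$. Oracle queries are on tags for which a witness can be so obtained. **Zero-knowledge** of $\Pi$ for a relation $\mathcal{R}$: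 there is a simulator $(\mathsf{Sim}_1,\mathsf{Sim}_2)$ such that every PPT adversary has negligible advantage in distinguishing (a) $\mathsf{CRS}\gets\Pi.\mathsf{Gen}(1^\lambda,\mathcal{R})$ with oracle access to $\Pi.\mathsf{Prove}(\mathsf{CRS},\cdot,\cdot)$ from (b) $(\mathsf{CRS},\mathsf{tpd})\gets\mathsf{Sim}_1(1^\lambda)$ with oracle access to $\mathsf{Sim}'(\mathsf{CRS},\mathsf{tpd},x,w)$, which equals $\mathsf{Sim}_2(\mathsf{CRS},\mathsf{tpd},x)$ if $(x,w)\in\mathcal{R}$ and $\bot$ otherwise. *)

theory Defs
  imports "HOL-Probability.Probability" "HOL-Computational_Algebra.Polynomial"
begin

section \<open>Probabilistic polynomial time\<close>

text \<open>
  Messages, keys, tags, proofs etc. are binary trees whose leaves are bits. Every element of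
  \<open>{0,1}\<^sup>*\<close> is such a tree (see \<open>bitstring\<close>), and tuples need no further encoding. Tuples
  associate to the right. The leaf \<open>fail\<close> also serves as the error symbol.
\<close>

datatype data = Bit bool | Tup data data  (infixr "\<diamondop>" 65)

abbreviation fail :: data where "fail \<equiv> Bit False"

primrec len :: "data \<Rightarrow> nat" where
  "len (Bit b) = 1"
| "len (x \<diamondop> y) = len x + len y + 1"

fun first :: "data \<Rightarrow> data" where
  "first (x \<diamondop> y) = x"
| "first (Bit b) = fail"

fun second :: "data \<Rightarrow> data" where
  "second (x \<diamondop> y) = y"
| "second (Bit b) = fail"

primrec bitstring :: "bool list \<Rightarrow> data" where
  "bitstring [] = fail"
| "bitstring (b # bs) = Bit b \<diamondop> bitstring bs"

text \<open>
  A program maps a tree to a tree. It may read the security parameter in unary, toss a fair coin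
  and query an oracle. \<open>WhileP p\<close> iterates \<open>p\<close> as long as the first component of the current tree
  is the bit 1.
\<close>

datatype prim = Const data | SecParam | IdP | Fst | Snd | IsTup | Eq

datatype prog =
    Prim prim
  | Flip
  | Query
  | SeqP prog prog
  | ForkP prog prog
  | IfP prog prog prog
  | WhileP prog

primrec prim_sem :: "nat \<Rightarrow> prim \<Rightarrow> data \<Rightarrow> data" where
  "prim_sem n (Const d) x = d"
| "prim_sem n SecParam x = bitstring (replicate n True)"
| "prim_sem n IdP x = x"
| "prim_sem n Fst x = first x"
| "prim_sem n Snd x = second x"
| "prim_sem n IsTup x = Bit (case x of Bit b \<Rightarrow> False | y \<diamondop> z \<Rightarrow> True)"
| "prim_sem n Eq x = Bit (first x = second x)"

partial_function (spmf) while_spmf :: "('a \<Rightarrow> bool) \<Rightarrow> ('a \<Rightarrow> 'a spmf) \<Rightarrow> 'a \<Rightarrow> 'a spmf" where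
  "while_spmf guard body s =
     (if guard s then bind_spmf (body s) (while_spmf guard body) else return_spmf s)"

text \<open>
  \<open>exec \<O> n p x\<close> is the joint distribution of result and running time of \<open>p\<close> on input \<open>x\<close>, with
  security parameter \<open>n\<close> and oracle \<open>\<O>\<close>; the missing probability mass is that of divergence.
  Atomic steps, oracle calls included, cost the length of their input plus the length of their
  output, so the running time also bounds the length of everything that is computed.
\<close>

definition charged :: "data \<Rightarrow> data pmf \<Rightarrow> (data \<times> nat) spmf" where
  "charged x D = spmf_of_pmf (map_pmf (\<lambda>y. (y, len x + len y)) D)"

primrec exec :: "(data \<Rightarrow> data pmf) \<Rightarrow> nat \<Rightarrow> prog \<Rightarrow> data \<Rightarrow> (data \<times> nat) spmf" where
  "exec \<O> n (Prim f) x = charged x (return_pmf (prim_sem n f x))"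
| "exec \<O> n Flip x = charged x (map_pmf Bit (bernoulli_pmf (1/2)))"
| "exec \<O> n Query x = charged x (\<O> x)"
| "exec \<O> n (SeqP p q) x =
     bind_spmf (exec \<O> n p x) (\<lambda>(y, s).
     bind_spmf (exec \<O> n q y) (\<lambda>(z, t).
     return_spmf (z, s + t + 1)))"
| "exec \<O> n (ForkP p q) x =
     bind_spmf (exec \<O> n p x) (\<lambda>(y, s).
     bind_spmf (exec \<O> n q x) (\<lambda>(z, t).
     return_spmf (y \<diamondop> z, s + t + 1)))"
| "exec \<O> n (IfP p q r) x =
     bind_spmf (exec \<O> n p x) (\<lambda>(b, s).
     bind_spmf (if b = Bit True then exec \<O> n q x else exec \<O> n r x) (\<lambda>(y, t).
     return_spmf (y, s + t + 1)))"
| "exec \<O> n (WhileP p) x =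
     while_spmf (\<lambda>(y, s). first y = Bit True)
       (\<lambda>(y, s). bind_spmf (exec \<O> n p y) (\<lambda>(z, t). return_spmf (z, s + t + 1)))
       (x, len x)"

definition runs_within :: "(data \<times> nat) spmf \<Rightarrow> nat \<Rightarrow> bool" where
  "runs_within D b \<longleftrightarrow> lossless_spmf D \<and> (\<forall>(y, t)\<in>set_spmf D. t \<le> b)"

text \<open>
  A randomised algorithm, given by its output distributions, is PPT if a program computes it
  (without help from an oracle) in strict time polynomial in security parameter and input length.
\<close>

definition ppt :: "(nat \<Rightarrow> data \<Rightarrow> data pmf) \<Rightarrow> bool" where
  "ppt f \<longleftrightarrow> (\<exists>p. \<exists>b :: nat poly. \<forall>\<O> n x.
     map_spmf fst (exec \<O> n p x) = spmf_of_pmf (f n x) \<and>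
     runs_within (exec \<O> n p x) (poly b (n + len x)))"

text \<open>
  A PPT oracle machine must be strictly polynomial-time for every oracle with polynomially bounded
  answers. The bound on the answers is needed because receiving an answer is charged for. Programs
  that stop themselves by a polynomial clock qualify.
\<close>

definition poly_bounded_oracle :: "nat poly \<Rightarrow> nat \<Rightarrow> (data \<Rightarrow> data pmf) \<Rightarrow> bool" where
  "poly_bounded_oracle q n \<O> \<longleftrightarrow> (\<forall>x. \<forall>y\<in>set_pmf (\<O> x). len y \<le> poly q (n + len x))"

definition ppt_adversary :: "prog \<Rightarrow> bool" where
  "ppt_adversary A \<longleftrightarrow> (\<forall>q. \<exists>b :: nat poly. \<forall>n \<O> x.
     poly_bounded_oracle q n \<O> \<longrightarrow> runs_within (exec \<O> n A x) (poly b (n + len x)))"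

definition adv_output :: "(data \<Rightarrow> data pmf) \<Rightarrow> nat \<Rightarrow> prog \<Rightarrow> data \<Rightarrow> bool spmf" where
  "adv_output \<O> n A x = map_spmf (\<lambda>(y, t). y = Bit True) (exec \<O> n A x)"

definition negligible :: "(nat \<Rightarrow> real) \<Rightarrow> bool" where
  "negligible f \<longleftrightarrow> (\<forall>c::nat. \<forall>\<^sub>F n in sequentially. \<bar>f n\<bar> < 1 / real n ^ c)"

section \<open>Building blocks\<close>

text \<open>Algorithms taking several arguments receive them as a tuple.\<close>

definition ppt_fun :: "(data \<Rightarrow> data) \<Rightarrow> bool" where
  "ppt_fun f \<longleftrightarrow> ppt (\<lambda>n x. return_pmf (f x))"

definition pair_data :: "data \<times> data \<Rightarrow> data" where
  "pair_data = (\<lambda>(x, y). x \<diamondop> y)"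

record sig_scheme =
  sig_gen :: "nat \<Rightarrow> (data \<times> data) pmf"   \<comment> \<open>verification key, signing key\<close>
  sig_sign :: "data \<Rightarrow> data \<Rightarrow> data pmf"
  sig_verify :: "data \<Rightarrow> data \<Rightarrow> data \<Rightarrow> bool"

definition sig_ppt :: "sig_scheme \<Rightarrow> bool" where
  "sig_ppt S \<longleftrightarrow>
     ppt (\<lambda>n _. map_pmf pair_data (sig_gen S n)) \<and>
     ppt (\<lambda>n x. sig_sign S (first x) (second x)) \<and>
     ppt_fun (\<lambda>x. Bit (sig_verify S (first x) (first (second x)) (second (second x))))"

definition valid_key_pair :: "sig_scheme \<Rightarrow> data \<Rightarrow> data \<Rightarrow> bool" where
  "valid_key_pair S sk vk \<longleftrightarrow> (\<exists>n. (vk, sk) \<in> set_pmf (sig_gen S n))"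

record jwt_scheme =
  jwt_issue :: "data \<Rightarrow> data \<Rightarrow> data pmf"
  jwt_verify :: "data \<Rightarrow> data \<Rightarrow> bool"
  jwt_stid :: "data \<Rightarrow> data"
  jwt_aud :: "data \<Rightarrow> data"
  jwt_iss :: "data \<Rightarrow> data"
  jwt_nonce :: "data \<Rightarrow> data"

definition jwt_ppt :: "jwt_scheme \<Rightarrow> bool" where
  "jwt_ppt J \<longleftrightarrow>
     ppt (\<lambda>n x. jwt_issue J (first x) (second x)) \<and>
     ppt_fun (\<lambda>x. Bit (jwt_verify J (first x) (second x)))"

section \<open>NIZK schemes and zero-knowledge\<close>

type_synonym relation = "(data \<times> data) set"

record nizk =
  nizk_gen :: "nat \<Rightarrow> relation \<Rightarrow> data pmf"
  nizk_prove :: "nat \<Rightarrow> data \<Rightarrow> data \<Rightarrow> data \<Rightarrow> data pmf"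
  nizk_verify :: "data \<Rightarrow> data \<Rightarrow> data \<Rightarrow> bool"

definition nizk_ppt :: "nizk \<Rightarrow> relation \<Rightarrow> bool" where
  "nizk_ppt \<N> R \<longleftrightarrow>
     ppt (\<lambda>n _. nizk_gen \<N> n R) \<and>
     ppt (\<lambda>n x. nizk_prove \<N> n (first x) (first (second x)) (second (second x))) \<and>
     ppt_fun (\<lambda>x. Bit (nizk_verify \<N> (first x) (first (second x)) (second (second x))))"

definition prove_oracle :: "nizk \<Rightarrow> nat \<Rightarrow> data \<Rightarrow> data \<Rightarrow> data pmf" where
  "prove_oracle \<N> n crs q =
     (case q of x \<diamondop> w \<Rightarrow> nizk_prove \<N> n crs x w | Bit _ \<Rightarrow> return_pmf fail)"

definition sim_prove_oracle ::
    "relation \<Rightarrow> (nat \<Rightarrow> data \<Rightarrow> data \<Rightarrow> data \<Rightarrow> data pmf) \<Rightarrow> nat \<Rightarrow> data \<Rightarrow> data \<Rightarrow> data \<Rightarrow> data pmf" where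
  "sim_prove_oracle R Sim2 n crs tpd q =
     (case q of
        x \<diamondop> w \<Rightarrow> if (x, w) \<in> R then Sim2 n crs tpd x else return_pmf fail
      | Bit _ \<Rightarrow> return_pmf fail)"

definition zk_real :: "nizk \<Rightarrow> relation \<Rightarrow> prog \<Rightarrow> nat \<Rightarrow> bool spmf" where
  "zk_real \<N> R A n =
     bind_spmf (spmf_of_pmf (nizk_gen \<N> n R)) (\<lambda>crs. adv_output (prove_oracle \<N> n crs) n A crs)"

definition zk_sim ::
    "relation \<Rightarrow> (nat \<Rightarrow> (data \<times> data) pmf) \<Rightarrow> (nat \<Rightarrow> data \<Rightarrow> data \<Rightarrow> data \<Rightarrow> data pmf) \<Rightarrow>
     prog \<Rightarrow> nat \<Rightarrow> bool spmf" where
  "zk_sim R Sim1 Sim2 A n =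
     bind_spmf (spmf_of_pmf (Sim1 n)) (\<lambda>(crs, tpd).
       adv_output (sim_prove_oracle R Sim2 n crs tpd) n A crs)"

definition zero_knowledge :: "nizk \<Rightarrow> relation \<Rightarrow> bool" where
  "zero_knowledge \<N> R \<longleftrightarrow> (\<exists>Sim1 Sim2.
     ppt (\<lambda>n _. map_pmf pair_data (Sim1 n)) \<and>
     ppt (\<lambda>n x. Sim2 n (first x) (first (second x)) (second (second x))) \<and>
     (\<forall>A. ppt_adversary A \<longrightarrow>
        negligible (\<lambda>n. \<bar>spmf (zk_real \<N> R A n) True - spmf (zk_sim R Sim1 Sim2 A n) True\<bar>)))"

section \<open>Tagged witness signatures and witness hiding\<close>

record tws =
  tws_gen :: "nat \<Rightarrow> data pmf"
  tws_sign :: "nat \<Rightarrow> data \<Rightarrow> data \<Rightarrow> data \<Rightarrow> data \<Rightarrow> data pmf"   \<comment> \<open>tag, public key, witness, message\<close>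
  tws_verify :: "data \<Rightarrow> data \<Rightarrow> data \<Rightarrow> data \<Rightarrow> bool"   \<comment> \<open>tag, public key, message, signature\<close>

text \<open>
  A witness source models the parties from which the signing oracle obtains a witness for a tag:
  a distribution on witnesses, or \<open>None\<close> on tags for which none can be obtained. The oracles of both
  experiments answer \<open>fail\<close> on the latter; they are transparent to an adversary that only
  queries tags for which a witness can be obtained.
\<close>

type_synonym witness_source = "nat \<Rightarrow> data \<Rightarrow> data pmf option"

definition sound_source :: "(data \<Rightarrow> data \<Rightarrow> bool) \<Rightarrow> witness_source \<Rightarrow> bool" where
  "sound_source P W \<longleftrightarrow> (\<forall>n t D. W n t = Some D \<longrightarrow> (\<forall>w\<in>set_pmf D. P t w))"

definition sign_oracle :: "tws \<Rightarrow> witness_source \<Rightarrow> nat \<Rightarrow> data \<Rightarrow> data \<Rightarrow> data pmf" where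
  "sign_oracle \<S> W n pk q =
     (case q of
        t \<diamondop> m \<Rightarrow> (case W n t of
            None \<Rightarrow> return_pmf fail
          | Some D \<Rightarrow> bind_pmf D (\<lambda>w. tws_sign \<S> n t pk w m))
      | Bit _ \<Rightarrow> return_pmf fail)"

definition sim_sign_oracle ::
    "(nat \<Rightarrow> data \<Rightarrow> data \<Rightarrow> data \<Rightarrow> data \<Rightarrow> data pmf) \<Rightarrow> witness_source \<Rightarrow> nat \<Rightarrow> data \<Rightarrow> data \<Rightarrow>
     data \<Rightarrow> data pmf" where
  "sim_sign_oracle SimSign W n pk trap q =
     (case q of
        t \<diamondop> m \<Rightarrow> (case W n t of
            None \<Rightarrow> return_pmf fail
          | Some _ \<Rightarrow> SimSign n t pk trap m)
      | Bit _ \<Rightarrow> return_pmf fail)"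

definition expt_real :: "tws \<Rightarrow> witness_source \<Rightarrow> prog \<Rightarrow> nat \<Rightarrow> bool spmf" where
  "expt_real \<S> W A n =
     bind_spmf (spmf_of_pmf (tws_gen \<S> n)) (\<lambda>pk. adv_output (sign_oracle \<S> W n pk) n A pk)"

definition expt_sim ::
    "(nat \<Rightarrow> (data \<times> data) pmf) \<Rightarrow> (nat \<Rightarrow> data \<Rightarrow> data \<Rightarrow> data \<Rightarrow> data \<Rightarrow> data pmf) \<Rightarrow>
     witness_source \<Rightarrow> prog \<Rightarrow> nat \<Rightarrow> bool spmf" where
  "expt_sim SimGen SimSign W A n =
     bind_spmf (spmf_of_pmf (SimGen n)) (\<lambda>(pk, trap).
       adv_output (sim_sign_oracle SimSign W n pk trap) n A pk)"

text \<open>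
  The simulators are chosen before the witness source: otherwise a simulator could have the secrets
  behind the source built in and just sign honestly.
\<close>

definition witness_hiding ::
    "(data \<Rightarrow> data \<Rightarrow> bool) \<Rightarrow> tws \<Rightarrow> witness_source set \<Rightarrow> bool" where
  "witness_hiding P \<S> \<W> \<longleftrightarrow> (\<forall>A. ppt_adversary A \<longrightarrow> (\<exists>SimGen SimSign.
     ppt (\<lambda>n _. map_pmf pair_data (SimGen n)) \<and>
     ppt (\<lambda>n x. SimSign n (first x) (first (second x)) (first (second (second x)))
                  (second (second (second x)))) \<and>
     (\<forall>W\<in>\<W>. sound_source P W \<longrightarrow>
        negligible (\<lambda>n. \<bar>spmf (expt_real \<S> W A n) True
                         - spmf (expt_sim SimGen SimSign W A n) True\<bar>))))"

section \<open>The zkLogin scheme\<close>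

definition P_zkLogin ::
    "(data \<Rightarrow> data) \<Rightarrow> sig_scheme \<Rightarrow> jwt_scheme \<Rightarrow> data \<Rightarrow> data \<Rightarrow> bool" where
  "P_zkLogin H S J t w \<longleftrightarrow> (\<exists>pk_OP iss zkaddr T jwt salt r vk_u sk_u.
     t = pk_OP \<diamondop> iss \<diamondop> zkaddr \<diamondop> T \<and>
     w = jwt \<diamondop> salt \<diamondop> r \<diamondop> vk_u \<diamondop> sk_u \<and>
     zkaddr = H (jwt_stid J jwt \<diamondop> jwt_aud J jwt \<diamondop> jwt_iss J jwt \<diamondop> salt) \<and>
     jwt_iss J jwt = iss \<and>
     jwt_nonce J jwt = H (vk_u \<diamondop> T \<diamondop> r) \<and>
     jwt_verify J pk_OP jwt \<and>
     valid_key_pair S sk_u vk_u)"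

definition Ckt :: "(data \<Rightarrow> data) \<Rightarrow> jwt_scheme \<Rightarrow> relation" where
  "Ckt H J = {(zkx, zkw). \<exists>pk_OP iss zkaddr T vk_u jwt salt r.
     zkx = pk_OP \<diamondop> iss \<diamondop> zkaddr \<diamondop> T \<diamondop> vk_u \<and>
     zkw = jwt \<diamondop> salt \<diamondop> r \<and>
     zkaddr = H (jwt_stid J jwt \<diamondop> jwt_aud J jwt \<diamondop> jwt_iss J jwt \<diamondop> salt) \<and>
     jwt_iss J jwt = iss \<and>
     jwt_nonce J jwt = H (vk_u \<diamondop> T \<diamondop> r) \<and>
     jwt_verify J pk_OP jwt}"

fun zkLogin_sign ::
    "sig_scheme \<Rightarrow> nizk \<Rightarrow> nat \<Rightarrow> data \<Rightarrow> data \<Rightarrow> data \<Rightarrow> data \<Rightarrow> data pmf" where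
  "zkLogin_sign S \<N> n (pk_OP \<diamondop> iss \<diamondop> zkaddr \<diamondop> T) zkcrs (jwt \<diamondop> salt \<diamondop> r \<diamondop> vk_u \<diamondop> sk_u) M =
     bind_pmf (sig_sign S sk_u M) (\<lambda>\<sigma>_u.
     bind_pmf (nizk_prove \<N> n zkcrs (pk_OP \<diamondop> iss \<diamondop> zkaddr \<diamondop> T \<diamondop> vk_u) (jwt \<diamondop> salt \<diamondop> r)) (\<lambda>\<pi>.
     return_pmf (vk_u \<diamondop> T \<diamondop> \<sigma>_u \<diamondop> \<pi>)))"
| "zkLogin_sign S \<N> n _ zkcrs _ M = return_pmf fail"

fun zkLogin_verify :: "sig_scheme \<Rightarrow> nizk \<Rightarrow> data \<Rightarrow> data \<Rightarrow> data \<Rightarrow> data \<Rightarrow> bool" where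
  "zkLogin_verify S \<N> (pk_OP \<diamondop> iss \<diamondop> zkaddr \<diamondop> T) zkcrs M (vk_u \<diamondop> T' \<diamondop> \<sigma>_u \<diamondop> \<pi>) \<longleftrightarrow>
     T' = T \<and> sig_verify S vk_u M \<sigma>_u \<and>
     nizk_verify \<N> zkcrs (pk_OP \<diamondop> iss \<diamondop> zkaddr \<diamondop> T \<diamondop> vk_u) \<pi>"
| "zkLogin_verify S \<N> _ zkcrs M _ \<longleftrightarrow> False"

definition zkLogin :: "(data \<Rightarrow> data) \<Rightarrow> sig_scheme \<Rightarrow> jwt_scheme \<Rightarrow> nizk \<Rightarrow> tws" where
  "zkLogin H S J \<N> =
     \<lparr> tws_gen = (\<lambda>n. nizk_gen \<N> n (Ckt H J)),
       tws_sign = zkLogin_sign S \<N>,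
       tws_verify = zkLogin_verify S \<N> \<rparr>"

text \<open>
  The honest parties: for an issuer, the OP's key pair (signing key, public key); for an address,
  the values \<open>stid\<close>, \<open>aud\<close>, \<open>salt\<close> of the user and application owning it. Like all parties of the
  experiments they are efficient.
\<close>

record environment =
  op_keys :: "nat \<Rightarrow> data \<Rightarrow> (data \<times> data) option"
  owner :: "nat \<Rightarrow> data \<Rightarrow> (data \<times> data \<times> data) option"

definition environment_ppt :: "environment \<Rightarrow> bool" where
  "environment_ppt E \<longleftrightarrow>
     ppt (\<lambda>n iss. return_pmf (case op_keys E n iss of
            None \<Rightarrow> fail | Some (sk, pk) \<Rightarrow> Bit True \<diamondop> sk \<diamondop> pk)) \<and>
     ppt (\<lambda>n zkaddr. return_pmf (case owner E n zkaddr of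
            None \<Rightarrow> fail | Some (stid, aud, salt) \<Rightarrow> Bit True \<diamondop> stid \<diamondop> aud \<diamondop> salt))"

definition sample_witness ::
    "(data \<Rightarrow> data) \<Rightarrow> sig_scheme \<Rightarrow> jwt_scheme \<Rightarrow> nat \<Rightarrow>
     data \<Rightarrow> data \<Rightarrow> data \<Rightarrow> data \<Rightarrow> data \<Rightarrow> data \<Rightarrow> data pmf" where
  "sample_witness H S J n sk_OP stid aud iss salt T =
     bind_pmf (sig_gen S n) (\<lambda>(vk_u, sk_u).
     bind_pmf (map_pmf bitstring (pmf_of_set {bs. length bs = n})) (\<lambda>r.
     bind_pmf (jwt_issue J sk_OP (stid \<diamondop> aud \<diamondop> iss \<diamondop> H (vk_u \<diamondop> T \<diamondop> r))) (\<lambda>jwt.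
     return_pmf (jwt \<diamondop> salt \<diamondop> r \<diamondop> vk_u \<diamondop> sk_u))))"

fun zkLogin_source ::
    "(data \<Rightarrow> data) \<Rightarrow> sig_scheme \<Rightarrow> jwt_scheme \<Rightarrow> environment \<Rightarrow> witness_source" where
  "zkLogin_source H S J E n (pk_OP \<diamondop> iss \<diamondop> zkaddr \<diamondop> T) =
     (case (op_keys E n iss, owner E n zkaddr) of
        (Some (sk_OP, pk), Some (stid, aud, salt)) \<Rightarrow>
          if pk_OP = pk \<and> zkaddr = H (stid \<diamondop> aud \<diamondop> iss \<diamondop> salt)
          then Some (sample_witness H S J n sk_OP stid aud iss salt T) else None
      | _ \<Rightarrow> None)"
| "zkLogin_source H S J E n _ = None"

definition zkLogin_sources ::
    "(data \<Rightarrow> data) \<Rightarrow> sig_scheme \<Rightarrow> jwt_scheme \<Rightarrow> witness_source set" where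
  "zkLogin_sources H S J = {zkLogin_source H S J E | E. environment_ppt E}"

text \<open>
  Soundness of these sources with respect to \<open>P_zkLogin\<close> is merely correctness of the OPs' tokens.
\<close>

lemma sound_zkLogin_source:
  assumes "\<And>n iss sk pk stid aud nonce jwt.
      op_keys E n iss = Some (sk, pk) \<Longrightarrow>
      jwt \<in> set_pmf (jwt_issue J sk (stid \<diamondop> aud \<diamondop> iss \<diamondop> nonce)) \<Longrightarrow>
      jwt_verify J pk jwt \<and> jwt_stid J jwt = stid \<and> jwt_aud J jwt = aud \<and>
      jwt_iss J jwt = iss \<and> jwt_nonce J jwt = nonce"
  shows "sound_source (P_zkLogin H S J) (zkLogin_source H S J E)"
  unfolding sound_source_def
proof (intro allI impI ballI)
  fix n t D w
  assume D: "zkLogin_source H S J E n t = Some D" and w: "w \<in> set_pmf D"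
  from D obtain pk iss zkaddr T sk stid aud salt where
    t: "t = pk \<diamondop> iss \<diamondop> zkaddr \<diamondop> T" and sk: "op_keys E n iss = Some (sk, pk)"
    and addr: "zkaddr = H (stid \<diamondop> aud \<diamondop> iss \<diamondop> salt)"
    and D': "D = sample_witness H S J n sk stid aud iss salt T"
    by (cases "(H, S, J, E, n, t)" rule: zkLogin_source.cases)
       (auto split: option.splits if_splits)
  from w obtain vk sk_u r jwt where
    "(vk, sk_u) \<in> set_pmf (sig_gen S n)"
    and "jwt \<in> set_pmf (jwt_issue J sk (stid \<diamondop> aud \<diamondop> iss \<diamondop> H (vk \<diamondop> T \<diamondop> r)))"
    and "w = jwt \<diamondop> salt \<diamondop> r \<diamondop> vk \<diamondop> sk_u"
    unfolding D' sample_witness_def by auto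
  then show "P_zkLogin H S J t w"
    using assms[OF sk] unfolding P_zkLogin_def valid_key_pair_def t addr
    by blast
qed

end

theory Submission
  imports Defs
begin

text \<open>
  The NIZK simulator serves as \<open>SimGen\<close>; \<open>SimSign\<close> draws its own key pair, signs the message with it
  and simulates the proof. A signing query only needs the prover as an oracle: everything else
  (looking up keys and owner, sampling the witness, signing) is polynomial-time. Replacing the
  queries of a witness-hiding adversary by that computation yields a zero-knowledge adversary.
  Against the honest prover it plays the real experiment, and against the simulated one exactly the
  simulated experiment: soundness of the source puts all queries into \<open>Ckt\<close>, and then the sampled
  token and randomness no longer influence the answer. So the two advantages coincide.
\<close>

section \<open>Couplings of loops\<close>

text \<open>The invariant rule of partial correctness: inclusion of the support in a fixed set is
  admissible and holds for the empty subdistribution, so fixpoint induction applies.\<close>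

lemma set_while_spmf:
  assumes step: "\<And>s. I s \<Longrightarrow> g s \<Longrightarrow> \<forall>s'\<in>set_spmf (b s). I s'" and "I s"
  shows "\<forall>s'\<in>set_spmf (while_spmf g b s). I s'"
proof -
  have "\<forall>s. I s \<longrightarrow> set_spmf (while_spmf g b s) \<subseteq> Collect I"
  proof (induction rule: while_spmf.fixp_induct)
    case 1
    show ?case
      by (intro cont_intro) (simp_all add: curry_def)
  next
    case 2
    show ?case by simp
  next
    case (3 f)
    show ?case
    proof (intro allI impI)
      fix s assume "I s"
      with 3 step[OF this] show "set_spmf (if g s then bind_spmf (b s) (f g b) else return_spmf s) \<subseteq> Collect I"
        by (auto simp: set_bind_spmf bind_UNION)
    qed
  qed
  with \<open>I s\<close> show ?thesis by blast
qed

text \<open>On states satisfying \<open>I\<close>, \<open>h\<close> is a homomorphism from one loop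
  to the other. Each inequality follows by fixpoint induction on the loop on its smaller side;
  antisymmetry joins them.\<close>

lemma map_spmf_while:
  assumes guard: "\<And>s. I s \<Longrightarrow> g s \<longleftrightarrow> g' (h s)"
    and step: "\<And>s. I s \<Longrightarrow> g s \<Longrightarrow> \<forall>s'\<in>set_spmf (b s). I s'"
    and body: "\<And>s. I s \<Longrightarrow> g s \<Longrightarrow> map_spmf h (b s) = b' (h s)"
    and "I s"
  shows "map_spmf h (while_spmf g b s) = while_spmf g' b' (h s)"
proof (rule spmf.leq_antisym)
  have "\<forall>s. I s \<longrightarrow> ord_spmf (=) (map_spmf h (while_spmf g b s)) (while_spmf g' b' (h s))"
  proof (induction rule: while_spmf.fixp_induct[where
      P="\<lambda>f. \<forall>s. I s \<longrightarrow> ord_spmf (=) (map_spmf h (f g b s)) (while_spmf g' b' (h s))"])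
    case 1
    show ?case by (intro cont_intro) (simp_all add: curry_def)
  next
    case 2
    show ?case by simp
  next
    case (3 f)
    show ?case
    proof (intro allI impI)
      fix s assume s: "I s"
      have "ord_spmf (=) (bind_spmf (b s) (\<lambda>x. map_spmf h (f g b x)))
              (bind_spmf (b s) (\<lambda>x. while_spmf g' b' (h x)))" if "g s"
        using 3 step[OF s that] by (intro ord_spmf_bind_reflI) auto
      then show "ord_spmf (=) (map_spmf h (if g s then bind_spmf (b s) (f g b) else return_spmf s))
              (while_spmf g' b' (h s))"
        using guard[OF s] body[OF s]
        by (subst while_spmf.simps)
           (auto simp: map_spmf_bind_spmf o_def bind_map_spmf simp flip: body[OF s])
    qed
  qed
  with \<open>I s\<close> show "ord_spmf (=) (map_spmf h (while_spmf g b s)) (while_spmf g' b' (h s))" by blast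
next
  have "\<forall>s. I s \<longrightarrow> ord_spmf (=) (while_spmf g' b' (h s)) (map_spmf h (while_spmf g b s))"
  proof (induction rule: while_spmf.fixp_induct[where
      P="\<lambda>f. \<forall>s. I s \<longrightarrow> ord_spmf (=) (f g' b' (h s)) (map_spmf h (while_spmf g b s))"])
    case 1
    show ?case by (intro cont_intro) (simp_all add: curry_def)
  next
    case 2
    show ?case by simp
  next
    case (3 f)
    show ?case
    proof (intro allI impI)
      fix s assume s: "I s"
      have "ord_spmf (=) (bind_spmf (b s) (\<lambda>x. f g' b' (h x)))
              (bind_spmf (b s) (\<lambda>x. map_spmf h (while_spmf g b x)))" if "g s"
        using 3 step[OF s that] by (intro ord_spmf_bind_reflI) auto
      then show "ord_spmf (=) (if g' (h s) then bind_spmf (b' (h s)) (f g' b') else return_spmf (h s))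
              (map_spmf h (while_spmf g b s))"
        using guard[OF s]
        by (subst while_spmf.simps)
           (auto simp: map_spmf_bind_spmf o_def bind_map_spmf simp flip: body[OF s])
    qed
  qed
  with \<open>I s\<close> show "ord_spmf (=) (while_spmf g' b' (h s)) (map_spmf h (while_spmf g b s))" by blast
qed

text \<open>
  The library shows \<open>rel_spmf R\<close> to be admissible only relative to the assumption
  \<open>rel_spmf_characterisation\<close>, so instead of fixpoint induction the coupling of the loops is built
  explicitly, as a loop over pairs of states.
\<close>

lemma rel_spmf_while:
  assumes guard: "\<And>s t. R s t \<Longrightarrow> g s \<longleftrightarrow> g' t"
    and body: "\<And>s t. R s t \<Longrightarrow> g s \<Longrightarrow> rel_spmf R (b s) (b' t)"
    and "R s t"
  shows "rel_spmf R (while_spmf g b s) (while_spmf g' b' t)"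
proof -
  \<comment> \<open>\<open>J\<close> couples one run of the two bodies. Off related pairs that pass
    the guard it is arbitrary, as the pair loop never runs it there.\<close>
  have "\<exists>J. \<forall>s t. R s t \<longrightarrow> g s \<longrightarrow> (\<forall>st\<in>set_spmf (J (s, t)). R (fst st) (snd st)) \<and>
      map_spmf fst (J (s, t)) = b s \<and> map_spmf snd (J (s, t)) = b' t"
  proof -
    have "\<exists>j. R s t \<longrightarrow> g s \<longrightarrow> (\<forall>st\<in>set_spmf j. R (fst st) (snd st)) \<and>
        map_spmf fst j = b s \<and> map_spmf snd j = b' t" for s t
      using body[of s t] by (metis rel_spmfE prod.collapse)
    then have "\<exists>J. \<forall>p. R (fst p) (snd p) \<longrightarrow> g (fst p) \<longrightarrow> (\<forall>st\<in>set_spmf (J p). R (fst st) (snd st)) \<and>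
        map_spmf fst (J p) = b (fst p) \<and> map_spmf snd (J p) = b' (snd p)"
      by (intro choice) auto
    then show ?thesis by (metis fst_conv snd_conv)
  qed
  then obtain J where
    J: "\<And>s t. R s t \<Longrightarrow> g s \<Longrightarrow> \<forall>st\<in>set_spmf (J (s, t)). R (fst st) (snd st)"
      "\<And>s t. R s t \<Longrightarrow> g s \<Longrightarrow> map_spmf fst (J (s, t)) = b s"
      "\<And>s t. R s t \<Longrightarrow> g s \<Longrightarrow> map_spmf snd (J (s, t)) = b' t"
    by blast
  let ?I = "\<lambda>p. R (fst p) (snd p)"
  let ?W = "while_spmf (\<lambda>p. g (fst p)) J (s, t)"
  show ?thesis
  proof (rule rel_spmfI)
    have "\<forall>p\<in>set_spmf ?W. ?I p"
      by (rule set_while_spmf) (use J \<open>R s t\<close> in auto)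
    then show "\<And>x y. (x, y) \<in> set_spmf ?W \<Longrightarrow> R x y" by fastforce
    show "map_spmf fst ?W = while_spmf g b s"
      using map_spmf_while[where I="?I" and h=fst and g="\<lambda>p. g (fst p)" and s="(s, t)" and b=J and g'=g and b'=b]
        J \<open>R s t\<close> by auto
    \<comment> \<open>The pair loop tests only the first component; by \<open>guard\<close> the
      second would decide alike.\<close>
    show "map_spmf snd ?W = while_spmf g' b' t"
      using map_spmf_while[where I="?I" and h=snd and g="\<lambda>p. g (fst p)" and s="(s, t)" and b=J and g'=g' and b'=b']
        J guard \<open>R s t\<close> by auto
  qed
qed

section \<open>Running time and substitution of queries\<close>

lemma len_pos: "len x > 0"
  by (cases x) auto

lemma poly_nat_mono: "x \<le> y \<Longrightarrow> poly (b :: nat poly) x \<le> poly b y"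
  by (induction b) (auto intro!: add_mono mult_mono)

lemma set_charged: "(y, t) \<in> set_spmf (charged x D) \<longleftrightarrow> y \<in> set_pmf D \<and> t = len x + len y"
  by (auto simp: charged_def)

lemma map_fst_charged: "map_spmf fst (charged x D) = spmf_of_pmf D"
  by (simp add: charged_def pmf.map_comp o_def)

text \<open>Atomic steps pay for their output, and the extra unit of \<open>ForkP\<close> pays for
  the new node. A loop starts its clock at \<open>len x\<close>, which covers the case of no
  iteration.\<close>

lemma len_le_time:
  "(y, t) \<in> set_spmf (exec \<O> n p x) \<Longrightarrow> len y \<le> t"
proof (induction p arbitrary: x y t)
  case (WhileP p)
  have "\<forall>(z, t)\<in>set_spmf (exec \<O> n (WhileP p) x). len z \<le> t"
    unfolding exec.simps
    by (rule set_while_spmf) (fastforce simp: set_bind_spmf dest: WhileP.IH)+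
  with WhileP.prems show ?case by blast
qed (fastforce simp: set_charged set_bind_spmf split: if_splits)+

primrec subst_query :: "prog \<Rightarrow> prog \<Rightarrow> prog" where
  "subst_query Q (Prim f) = Prim f"
| "subst_query Q Flip = Flip"
| "subst_query Q Query = Q"
| "subst_query Q (SeqP p q) = SeqP (subst_query Q p) (subst_query Q q)"
| "subst_query Q (ForkP p q) = ForkP (subst_query Q p) (subst_query Q q)"
| "subst_query Q (IfP p q r) = IfP (subst_query Q p) (subst_query Q q) (subst_query Q r)"
| "subst_query Q (WhileP p) = WhileP (subst_query Q p)"

text \<open>The coupling makes the results agree and relates the clocks by \<open>T\<close>. The
  trivial \<open>T\<close> will yield equality of outputs, an overhead bound the running time.
  \<open>add\<close> mirrors that compound constructs sum two times and add 1.\<close>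

lemma rel_spmf_exec_subst_query:
  fixes T :: "nat \<Rightarrow> nat \<Rightarrow> bool"
  defines "R \<equiv> \<lambda>(y, s) (z, t). y = z \<and> T s t"
  assumes Q: "\<And>x. rel_spmf R (exec \<O> n Q x) (charged x (\<O>' x))"
    and refl: "\<And>t. T t t"
    and add: "\<And>s s' t t'. T s s' \<Longrightarrow> T t t' \<Longrightarrow> T (s + t + 1) (s' + t' + 1)"
  shows "rel_spmf R (exec \<O> n (subst_query Q A) x) (exec \<O>' n A x)"
proof (induction A arbitrary: x)
  case (Prim f)
  show ?case by (auto intro!: rel_spmf_reflI simp: R_def refl)
next
  case Flip
  show ?case by (auto intro!: rel_spmf_reflI simp: R_def refl)
next
  case Query
  show ?case using Q by simp
next
  case (SeqP p q)
  have "rel_spmf R (exec \<O> n (subst_query Q q) y) (exec \<O>' n q z)" if "y = z" for y z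
    using SeqP.IH(2) that by simp
  then show ?case
    by (auto simp: R_def intro!: add[simplified] rel_spmf_bindI[OF SeqP.IH(1)] rel_spmf_bindI[where R=R])
next
  case (ForkP p q)
  show ?case
    by (auto simp: R_def intro!: add[simplified] rel_spmf_bindI[OF ForkP.IH(1)] rel_spmf_bindI[OF ForkP.IH(2)])
next
  case (IfP p q r)
  have "rel_spmf R (if b = Bit True then exec \<O> n (subst_query Q q) x else exec \<O> n (subst_query Q r) x)
          (if b = Bit True then exec \<O>' n q x else exec \<O>' n r x)" for b
    using IfP.IH by simp
  then show ?case
    by (auto simp: R_def intro!: add[simplified] rel_spmf_bindI[OF IfP.IH(1)] rel_spmf_bindI[where R=R])
next
  case (WhileP p)
  show ?case unfolding subst_query.simps exec.simps
  proof (rule rel_spmf_while)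
    fix s t assume "R s t"
    then show "(case s of (y, _) \<Rightarrow> first y = Bit True) = (case t of (y, _) \<Rightarrow> first y = Bit True)"
      by (auto simp: R_def)
    from \<open>R s t\<close> show "rel_spmf R
        (case s of (y, s) \<Rightarrow> bind_spmf (exec \<O> n (subst_query Q p) y) (\<lambda>(z, t). return_spmf (z, s + t + 1)))
        (case t of (y, s) \<Rightarrow> bind_spmf (exec \<O>' n p y) (\<lambda>(z, t). return_spmf (z, s + t + 1)))"
      by (auto simp: R_def intro!: add[simplified] rel_spmf_bindI[OF WhileP.IH])
  qed (simp add: R_def refl)
qed

section \<open>Composition of polynomial-time programs\<close>

definition outputs :: "(data \<Rightarrow> data pmf) \<Rightarrow> nat \<Rightarrow> prog \<Rightarrow> data \<Rightarrow> data pmf \<Rightarrow> bool" where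
  "outputs \<O> n p x D \<longleftrightarrow> map_spmf fst (exec \<O> n p x) = spmf_of_pmf D"

text \<open>Divergence is left aside: \<open>outputs\<close> already forces almost sure termination
  (\<open>outputs_lossless\<close>), so time bounds can be composed on their own.\<close>

definition halts_within :: "(data \<Rightarrow> data pmf) \<Rightarrow> nat \<Rightarrow> prog \<Rightarrow> data \<Rightarrow> nat \<Rightarrow> bool" where
  "halts_within \<O> n p x T \<longleftrightarrow> (\<forall>(y, t)\<in>set_spmf (exec \<O> n p x). t \<le> T)"

lemma outputs_lossless: "outputs \<O> n p x D \<Longrightarrow> lossless_spmf (exec \<O> n p x)"
  unfolding outputs_def by (metis lossless_map_spmf lossless_spmf_spmf_of_spmf)

lemma runs_withinI:
  "outputs \<O> n p x D \<Longrightarrow> halts_within \<O> n p x T \<Longrightarrow> runs_within (exec \<O> n p x) T"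
  by (simp add: runs_within_def halts_within_def outputs_lossless)

lemma runs_within_halts: "runs_within (exec \<O> n p x) T \<Longrightarrow> halts_within \<O> n p x T"
  by (simp add: runs_within_def halts_within_def)

lemma halts_within_mono: "halts_within \<O> n p x T \<Longrightarrow> T \<le> T' \<Longrightarrow> halts_within \<O> n p x T'"
  by (auto simp: halts_within_def)

lemma outputs_set:
  assumes "outputs \<O> n p x D" "(y, t) \<in> set_spmf (exec \<O> n p x)"
  shows "y \<in> set_pmf D"
proof -
  have "y \<in> fst ` set_spmf (exec \<O> n p x)"
    using assms(2) by force
  also have "\<dots> = set_pmf D"
    using assms(1) unfolding outputs_def by (metis set_map_spmf set_spmf_spmf_of_pmf)
  finally show ?thesis .
qed

text \<open>For composition: by \<open>len_le_time\<close>, the running time of one program limits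
  the input size of the next.\<close>

lemma halts_within_len:
  assumes "outputs \<O> n p x D" "halts_within \<O> n p x T" "y \<in> set_pmf D"
  shows "len y \<le> T"
proof -
  have "y \<in> fst ` set_spmf (exec \<O> n p x)"
    using assms(1,3) unfolding outputs_def by (metis set_map_spmf set_spmf_spmf_of_pmf)
  then obtain t where t: "(y, t) \<in> set_spmf (exec \<O> n p x)"
    by auto
  with assms(2) have "t \<le> T" by (auto simp: halts_within_def)
  with len_le_time[OF t] show ?thesis by simp
qed

text \<open>The continuation ignores the clock, so only the marginal of the result matters.\<close>

lemma bind_outputs:
  assumes "outputs \<O> n p x D"
  shows "bind_spmf (exec \<O> n p x) (\<lambda>(y, t). F y) = bind_pmf D F"
proof -
  have "bind_spmf (exec \<O> n p x) (\<lambda>(y, t). F y) = bind_spmf (map_spmf fst (exec \<O> n p x)) F"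
    by (simp add: bind_map_spmf o_def case_prod_unfold)
  then show ?thesis using assms by (simp add: outputs_def)
qed

lemma outputs_SeqP:
  assumes "outputs \<O> n p x D" "\<And>y. y \<in> set_pmf D \<Longrightarrow> outputs \<O> n q y (E y)"
  shows "outputs \<O> n (SeqP p q) x (bind_pmf D E)"
proof -
  have "map_spmf fst (exec \<O> n (SeqP p q) x) =
      bind_spmf (exec \<O> n p x) (\<lambda>(y, t). map_spmf fst (exec \<O> n q y))"
    by (simp add: map_spmf_bind_spmf o_def case_prod_unfold map_spmf_conv_bind_spmf)
  also have "\<dots> = bind_pmf D (\<lambda>y. spmf_of_pmf (E y))"
    unfolding bind_outputs[OF assms(1)] using assms(2)
    by (intro bind_pmf_cong) (auto simp: outputs_def)
  finally show ?thesis by (simp add: outputs_def spmf_of_pmf_bind)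
qed

lemma outputs_ForkP:
  assumes "outputs \<O> n p x D" "outputs \<O> n q x E"
  shows "outputs \<O> n (ForkP p q) x (bind_pmf D (\<lambda>y. bind_pmf E (\<lambda>z. return_pmf (y \<diamondop> z))))"
proof -
  have "map_spmf fst (exec \<O> n (ForkP p q) x) =
      bind_spmf (exec \<O> n p x) (\<lambda>(y, t). bind_spmf (exec \<O> n q x) (\<lambda>(z, t). return_spmf (y \<diamondop> z)))"
    by (simp add: map_spmf_bind_spmf o_def case_prod_unfold)
  then show ?thesis
    by (simp add: outputs_def bind_outputs[OF assms(1)] bind_outputs[OF assms(2)] spmf_of_pmf_bind)
qed

lemma outputs_IfP:
  assumes "outputs \<O> n p x (return_pmf (Bit c))"
    and "c \<Longrightarrow> outputs \<O> n q x D" "\<not> c \<Longrightarrow> outputs \<O> n r x E"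
  shows "outputs \<O> n (IfP p q r) x (if c then D else E)"
proof -
  have "map_spmf fst (exec \<O> n (IfP p q r) x) =
      bind_spmf (exec \<O> n p x) (\<lambda>(b, t). map_spmf fst (if b = Bit True then exec \<O> n q x else exec \<O> n r x))"
    by (simp add: map_spmf_bind_spmf o_def case_prod_unfold map_spmf_conv_bind_spmf)
  then show ?thesis
    using assms by (simp add: outputs_def bind_outputs[OF assms(1)] bind_return_pmf)
qed

lemma halts_within_SeqP:
  assumes out: "outputs \<O> n p x D" and p: "halts_within \<O> n p x T"
    and q: "\<And>y. y \<in> set_pmf D \<Longrightarrow> halts_within \<O> n q y U"
  shows "halts_within \<O> n (SeqP p q) x (T + U + 1)"
  unfolding halts_within_def
proof clarify
  fix z t
  assume "(z, t) \<in> set_spmf (exec \<O> n (SeqP p q) x)"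
  then obtain y s u where y: "(y, s) \<in> set_spmf (exec \<O> n p x)"
    and z: "(z, u) \<in> set_spmf (exec \<O> n q y)" and t: "t = s + u + 1"
    by (auto simp: set_bind_spmf)
  have "s \<le> T" using p y by (auto simp: halts_within_def)
  have "u \<le> U" using q[OF outputs_set[OF out y]] z by (auto simp: halts_within_def)
  with \<open>s \<le> T\<close> t show "t \<le> T + U + 1" by simp
qed

lemma halts_within_ForkP:
  assumes p: "halts_within \<O> n p x T" and q: "halts_within \<O> n q x U"
  shows "halts_within \<O> n (ForkP p q) x (T + U + 1)"
  unfolding halts_within_def
proof clarify
  fix z t
  assume "(z, t) \<in> set_spmf (exec \<O> n (ForkP p q) x)"
  then obtain y w s u where "(y, s) \<in> set_spmf (exec \<O> n p x)"
    and "(w, u) \<in> set_spmf (exec \<O> n q x)" and t: "t = s + u + 1"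
    by (auto simp: set_bind_spmf)
  then have "s \<le> T" "u \<le> U" using p q by (auto simp: halts_within_def)
  with t show "t \<le> T + U + 1" by simp
qed

text \<open>The branches contribute a sum in place of a maximum, which keeps the bounds
  polynomial.\<close>

lemma halts_within_IfP:
  assumes p: "halts_within \<O> n p x T" and q: "halts_within \<O> n q x U" and r: "halts_within \<O> n r x V"
  shows "halts_within \<O> n (IfP p q r) x (T + (U + V) + 1)"
  unfolding halts_within_def
proof clarify
  fix z t
  assume "(z, t) \<in> set_spmf (exec \<O> n (IfP p q r) x)"
  then obtain y s u where "(y, s) \<in> set_spmf (exec \<O> n p x)"
    and "(z, u) \<in> set_spmf (exec \<O> n q x) \<or> (z, u) \<in> set_spmf (exec \<O> n r x)" and t: "t = s + u + 1"
    by (fastforce simp: set_bind_spmf split: if_splits)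
  then have "s \<le> T" "u \<le> U \<or> u \<le> V" using p q r by (auto simp: halts_within_def)
  with t show "t \<le> T + (U + V) + 1" by auto
qed

text \<open>
  \<open>C q n\<close> selects the oracles for which the time bound has to hold; the bound may depend on \<open>q\<close>, but
  the program may not. Instances are \<open>\<lambda>_ _ _. True\<close>, which gives \<open>ppt\<close>, and \<open>poly_bounded_oracle\<close>.
\<close>

definition oracle_ppt ::
    "(nat poly \<Rightarrow> nat \<Rightarrow> (data \<Rightarrow> data pmf) \<Rightarrow> bool) \<Rightarrow>
     ((data \<Rightarrow> data pmf) \<Rightarrow> nat \<Rightarrow> data \<Rightarrow> data pmf) \<Rightarrow> bool" where
  "oracle_ppt C f \<longleftrightarrow> (\<exists>p b.
     (\<forall>\<O> n x. outputs \<O> n p x (f \<O> n x)) \<and>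
     (\<forall>q \<O> n x. C q n \<O> \<longrightarrow> halts_within \<O> n p x (poly (b q) (n + len x))))"

lemma oracle_pptI:
  assumes "\<And>\<O> n x. outputs \<O> n p x (f \<O> n x)"
    and "\<And>q \<O> n x. C q n \<O> \<Longrightarrow> halts_within \<O> n p x (poly (b q) (n + len x))"
  shows "oracle_ppt C f"
  using assms unfolding oracle_ppt_def by blast

lemma oracle_pptE:
  assumes "oracle_ppt C f"
  obtains p b where "\<And>\<O> n x. outputs \<O> n p x (f \<O> n x)"
    and "\<And>q \<O> n x. C q n \<O> \<Longrightarrow> halts_within \<O> n p x (poly (b q) (n + len x))"
  using assms unfolding oracle_ppt_def by blast

lemma pptE:
  assumes "ppt f"
  obtains p b where "\<And>\<O> n x. outputs \<O> n p x (f n x)"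
    and "\<And>\<O> n x. halts_within \<O> n p x (poly b (n + len x))"
  using assms unfolding ppt_def outputs_def by (metis runs_within_halts)

lemma pptI:
  assumes "\<And>\<O> n x. outputs \<O> n p x (f n x)"
    and "\<And>\<O> n x. halts_within \<O> n p x (poly b (n + len x))"
  shows "ppt f"
  unfolding ppt_def
  using assms by (intro exI[of _ p] exI[of _ b]) (auto simp: outputs_def intro: runs_withinI)

lemma ppt_iff_oracle_ppt: "ppt f \<longleftrightarrow> oracle_ppt (\<lambda>_ _ _. True) (\<lambda>_. f)"
proof
  assume "ppt f"
  then show "oracle_ppt (\<lambda>_ _ _. True) (\<lambda>_. f)"
    by (rule pptE) (rule oracle_pptI)
next
  assume "oracle_ppt (\<lambda>_ _ _. True) (\<lambda>_. f)"
  then show "ppt f"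
    by (rule oracle_pptE) (rule pptI, auto)
qed

lemma oracle_ppt_ppt: "ppt f \<Longrightarrow> oracle_ppt C (\<lambda>_. f)"
  by (erule pptE) (rule oracle_pptI)

section \<open>Closure rules for polynomial-time functions\<close>

lemma oracle_ppt_seq:
  assumes f: "oracle_ppt C f" and g: "oracle_ppt C g"
  shows "oracle_ppt C (\<lambda>\<O> n x. bind_pmf (f \<O> n x) (g \<O> n))"
proof -
  obtain p b where p: "\<And>\<O> n x. outputs \<O> n p x (f \<O> n x)"
    and b: "\<And>q \<O> n x. C q n \<O> \<Longrightarrow> halts_within \<O> n p x (poly (b q) (n + len x))"
    using f by (rule oracle_pptE) (rule that)
  obtain r c where r: "\<And>\<O> n x. outputs \<O> n r x (g \<O> n x)"
    and c: "\<And>q \<O> n x. C q n \<O> \<Longrightarrow> halts_within \<O> n r x (poly (c q) (n + len x))"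
    using g by (rule oracle_pptE) (rule that)
  show ?thesis
  proof (rule oracle_pptI[where p="SeqP p r"])
    show "outputs \<O> n (SeqP p r) x (bind_pmf (f \<O> n x) (g \<O> n))" for \<O> n x
      using p r by (rule outputs_SeqP)
    fix q n \<O> x assume C: "C q n \<O>"
    \<comment> \<open>The second input is no longer than the first running time, hence
      \<open>c q\<close> is composed with the identity plus \<open>b q\<close>.\<close>
    have "halts_within \<O> n (SeqP p r) x
        (poly (b q) (n + len x) + poly (c q) (n + len x + poly (b q) (n + len x)) + 1)"
      by (rule halts_within_SeqP[OF p b[OF C] halts_within_mono[OF c[OF C]]])
         (auto intro!: poly_nat_mono dest!: halts_within_len[OF p b[OF C]])
    then show "halts_within \<O> n (SeqP p r) x
        (poly (b q + pcompose (c q) ([:0, 1:] + b q) + 1) (n + len x))"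
      by (simp add: poly_pcompose)
  qed
qed

lemma oracle_ppt_fork:
  assumes f: "oracle_ppt C f" and g: "oracle_ppt C g"
  shows "oracle_ppt C (\<lambda>\<O> n x. bind_pmf (f \<O> n x) (\<lambda>y. bind_pmf (g \<O> n x) (\<lambda>z. return_pmf (y \<diamondop> z))))"
proof -
  obtain p b where p: "\<And>\<O> n x. outputs \<O> n p x (f \<O> n x)"
    and b: "\<And>q \<O> n x. C q n \<O> \<Longrightarrow> halts_within \<O> n p x (poly (b q) (n + len x))"
    using f by (rule oracle_pptE) (rule that)
  obtain r c where r: "\<And>\<O> n x. outputs \<O> n r x (g \<O> n x)"
    and c: "\<And>q \<O> n x. C q n \<O> \<Longrightarrow> halts_within \<O> n r x (poly (c q) (n + len x))"
    using g by (rule oracle_pptE) (rule that)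
  show ?thesis
  proof (rule oracle_pptI[where p="ForkP p r"])
    show "outputs \<O> n (ForkP p r) x
        (bind_pmf (f \<O> n x) (\<lambda>y. bind_pmf (g \<O> n x) (\<lambda>z. return_pmf (y \<diamondop> z))))" for \<O> n x
      using p r by (rule outputs_ForkP)
    show "halts_within \<O> n (ForkP p r) x (poly (b q + c q + 1) (n + len x))" if "C q n \<O>" for q n \<O> x
      unfolding poly_add poly_1 using that by (intro halts_within_ForkP b c)
  qed
qed

lemma oracle_ppt_if:
  assumes c: "oracle_ppt C (\<lambda>_ n x. return_pmf (Bit (c n x)))"
    and f: "oracle_ppt C f" and g: "oracle_ppt C g"
  shows "oracle_ppt C (\<lambda>\<O> n x. if c n x then f \<O> n x else g \<O> n x)"
proof -
  obtain p b where p: "\<And>\<O> n x. outputs \<O> n p x (return_pmf (Bit (c n x)))"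
    and b: "\<And>q \<O> n x. C q n \<O> \<Longrightarrow> halts_within \<O> n p x (poly (b q) (n + len x))"
    using c by (rule oracle_pptE) (rule that)
  obtain r d where r: "\<And>\<O> n x. outputs \<O> n r x (f \<O> n x)"
    and d: "\<And>q \<O> n x. C q n \<O> \<Longrightarrow> halts_within \<O> n r x (poly (d q) (n + len x))"
    using f by (rule oracle_pptE) (rule that)
  obtain s e where s: "\<And>\<O> n x. outputs \<O> n s x (g \<O> n x)"
    and e: "\<And>q \<O> n x. C q n \<O> \<Longrightarrow> halts_within \<O> n s x (poly (e q) (n + len x))"
    using g by (rule oracle_pptE) (rule that)
  show ?thesis
  proof (rule oracle_pptI[where p="IfP p r s"])
    show "outputs \<O> n (IfP p r s) x (if c n x then f \<O> n x else g \<O> n x)" for \<O> n x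
      using p r s by (intro outputs_IfP)
    show "halts_within \<O> n (IfP p r s) x (poly (b q + (d q + e q) + 1) (n + len x))"
      if "C q n \<O>" for q n \<O> x
      unfolding poly_add poly_1 using that by (intro halts_within_IfP b d e)
  qed
qed

lemma oracle_ppt_id: "oracle_ppt C (\<lambda>_ n x. return_pmf x)"
  by (rule oracle_pptI[where p="Prim IdP" and b="\<lambda>_. [:0, 2:]"])
     (auto simp: outputs_def map_fst_charged halts_within_def set_charged)

lemma len_bitstring: "len (bitstring bs) = 2 * length bs + 1"
  by (induction bs) auto

lemma len_prim_sem: "\<exists>b. \<forall>n x. len x + len (prim_sem n f x) \<le> poly b (n + len x)"
proof -
  have *: "len (first x) \<le> len x" "len (second x) \<le> len x" for x
    by (cases x; simp)+
  \<comment> \<open>The slope 3 covers \<open>SecParam\<close>, whose unary output has length 2n +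
    1; the constant term covers \<open>Const\<close> and single bits.\<close>
  have "len x + len (prim_sem n f x) \<le>
      poly [:1 + (case f of Const d \<Rightarrow> len d | _ \<Rightarrow> 1), 3:] (n + len x)" for n x
    using *[of x] by (cases f) (auto simp: len_bitstring)
  then show ?thesis by blast
qed

text \<open>The inner term \<open>h\<close> lets backward application follow the syntax of a term,
  thereby compiling it to a program. Several rules below share this shape.\<close>

lemma oracle_ppt_prim:
  assumes "oracle_ppt C (\<lambda>_ n x. return_pmf (h n x))"
  shows "oracle_ppt C (\<lambda>_ n x. return_pmf (prim_sem n f (h n x)))"
proof -
  obtain b where b: "\<And>n x. len x + len (prim_sem n f x) \<le> poly b (n + len x)"
    using len_prim_sem by blast
  have "oracle_ppt C (\<lambda>_ n x. return_pmf (prim_sem n f x))"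
    by (rule oracle_pptI[where p="Prim f" and b="\<lambda>_. b"])
       (auto simp: outputs_def map_fst_charged halts_within_def set_charged b)
  from oracle_ppt_seq[OF assms this] show ?thesis by (simp add: bind_return_pmf)
qed

lemma oracle_ppt_tup:
  assumes "oracle_ppt C (\<lambda>_ n x. return_pmf (h n x))" "oracle_ppt C (\<lambda>_ n x. return_pmf (k n x))"
  shows "oracle_ppt C (\<lambda>_ n x. return_pmf (h n x \<diamondop> k n x))"
  using oracle_ppt_fork[OF assms] by (simp add: bind_return_pmf)

lemmas oracle_ppt_first = oracle_ppt_prim[where f=Fst, simplified]
lemmas oracle_ppt_second = oracle_ppt_prim[where f=Snd, simplified]
lemmas oracle_ppt_const = oracle_ppt_prim[OF oracle_ppt_id, where f="Const d" for d, simplified]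
lemmas oracle_ppt_eq = oracle_ppt_prim[where f=Eq, OF oracle_ppt_tup, simplified]

lemma oracle_ppt_conj:
  assumes "oracle_ppt C (\<lambda>_ n x. return_pmf (Bit (P n x)))"
    and "oracle_ppt C (\<lambda>_ n x. return_pmf (Bit (Q n x)))"
  shows "oracle_ppt C (\<lambda>_ n x. return_pmf (Bit (P n x \<and> Q n x)))"
proof -
  have "oracle_ppt C (\<lambda>_ n x. if P n x then return_pmf (Bit (Q n x)) else return_pmf fail)"
    using assms oracle_ppt_const by (rule oracle_ppt_if)
  moreover have "(if P n x then return_pmf (Bit (Q n x)) else return_pmf fail) =
      return_pmf (Bit (P n x \<and> Q n x))" for n x
    by simp
  ultimately show ?thesis by (simp only:)
qed

text \<open>Bound variables live in tuples: the continuation receives the input and the drawn value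
  as a pair and reaches them by projections. Hence nested binds compile too.\<close>

lemma oracle_ppt_bind:
  assumes f: "oracle_ppt C f" and g: "oracle_ppt C (\<lambda>\<O> n z. g \<O> n (first z) (second z))"
  shows "oracle_ppt C (\<lambda>\<O> n x. bind_pmf (f \<O> n x) (g \<O> n x))"
proof -
  have "oracle_ppt C (\<lambda>\<O> n x. bind_pmf (bind_pmf (return_pmf x) (\<lambda>y. bind_pmf (f \<O> n x) (\<lambda>z. return_pmf (y \<diamondop> z))))
      (\<lambda>z. g \<O> n (first z) (second z)))"
    using oracle_ppt_fork[OF oracle_ppt_id f] g by (rule oracle_ppt_seq)
  then show ?thesis by (simp add: bind_return_pmf bind_assoc_pmf)
qed

lemma oracle_ppt_app:
  assumes "ppt f" "oracle_ppt C (\<lambda>_ n x. return_pmf (h n x))"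
  shows "oracle_ppt C (\<lambda>_ n x. f n (h n x))"
  using oracle_ppt_seq[OF assms(2) oracle_ppt_ppt[OF assms(1)]] by (simp add: bind_return_pmf)

lemma oracle_ppt_fun:
  assumes "ppt_fun f" "oracle_ppt C (\<lambda>_ n x. return_pmf (h n x))"
  shows "oracle_ppt C (\<lambda>_ n x. return_pmf (f (h n x)))"
  using assms unfolding ppt_fun_def by (rule oracle_ppt_app)

text \<open>Here the condition on the oracle enters: receiving the answer is charged, and
  \<open>q\<close> bounds its length.\<close>

lemma oracle_ppt_query:
  assumes "oracle_ppt poly_bounded_oracle (\<lambda>_ n x. return_pmf (h n x))"
  shows "oracle_ppt poly_bounded_oracle (\<lambda>\<O> n x. \<O> (h n x))"
proof -
  have "oracle_ppt poly_bounded_oracle (\<lambda>\<O> n x. \<O> x)"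
  proof (rule oracle_pptI[where p=Query and b="\<lambda>q. [:0, 1:] + q"])
    fix q n \<O> x assume "poly_bounded_oracle q n \<O>"
    then have "\<forall>y\<in>set_pmf (\<O> x). len x + len y \<le> (n + len x) + poly q (n + len x)"
      by (intro ballI add_mono) (auto simp: poly_bounded_oracle_def)
    then show "halts_within \<O> n Query x (poly ([:0, 1:] + q) (n + len x))"
      by (auto simp: halts_within_def set_charged)
  qed (simp add: outputs_def map_fst_charged)
  from oracle_ppt_seq[OF assms this] show ?thesis by (simp add: bind_return_pmf)
qed

lemma oracle_ppt_flip: "oracle_ppt C (\<lambda>_ n x. map_pmf Bit (bernoulli_pmf (1/2)))"
  by (rule oracle_pptI[where p=Flip and b="\<lambda>_. [:1, 1:]"])
     (auto simp: outputs_def map_fst_charged halts_within_def set_charged)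

section \<open>Random bit strings\<close>

lemma pair_pmf_of_set:
  assumes "finite A" "A \<noteq> {}" "finite B" "B \<noteq> {}"
  shows "pair_pmf (pmf_of_set A) (pmf_of_set B) = pmf_of_set (A \<times> B)"
proof (rule pmf_eqI)
  fix z
  show "pmf (pair_pmf (pmf_of_set A) (pmf_of_set B)) z = pmf (pmf_of_set (A \<times> B)) z"
    using assms by (cases z) (simp add: pmf_pair card_cartesian_product indicator_def)
qed

text \<open>Appending the bit is a bijection from pairs onto the longer lists, so it preserves
  uniformity. The bit goes to the end because the loop below prepends, which leaves the first bit
  drawn in last place.\<close>

lemma pmf_of_set_bitlists_Suc:
  "pmf_of_set {bs :: bool list. length bs = Suc k} =
     bind_pmf (bernoulli_pmf (1/2)) (\<lambda>b. map_pmf (\<lambda>bs. bs @ [b]) (pmf_of_set {bs. length bs = k}))"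
proof -
  have fin: "finite {bs :: bool list. length bs = k}"
    using finite_lists_length_eq[of "UNIV :: bool set" k] by simp
  have ne: "{bs :: bool list. length bs = k} \<noteq> {}"
    by (auto intro: exI[of _ "replicate k True"])
  have img: "(\<lambda>(b, bs). bs @ [b]) ` (UNIV \<times> {bs :: bool list. length bs = k}) = {bs. length bs = Suc k}"
    by (auto simp: image_iff length_Suc_conv_rev)
  have "pmf_of_set {bs :: bool list. length bs = Suc k} =
      map_pmf (\<lambda>(b, bs). bs @ [b]) (pmf_of_set (UNIV \<times> {bs. length bs = k}))"
    using fin ne by (subst map_pmf_of_set_inj) (auto simp: img inj_on_def)
  also have "pmf_of_set ((UNIV :: bool set) \<times> {bs :: bool list. length bs = k}) =
      pair_pmf (pmf_of_set UNIV) (pmf_of_set {bs. length bs = k})"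
    by (rule pair_pmf_of_set[OF _ _ fin ne, symmetric]) simp_all
  finally show ?thesis
    by (simp add: bernoulli_pmf_half_conv_pmf_of_set pair_pmf_def map_bind_pmf map_pmf_def
        bind_assoc_pmf bind_return_pmf)
qed

text \<open>
  A loop state: the flag demanded by \<open>WhileP\<close>, a unary counter \<open>k\<close> and the bits drawn so far.
\<close>

definition flip_state :: "nat \<Rightarrow> bool list \<Rightarrow> data" where
  "flip_state k bs = Bit (k > 0) \<diamondop> bitstring (replicate k True) \<diamondop> bitstring bs"

lemma first_flip_state: "first (flip_state k bs) = Bit True \<longleftrightarrow> k > 0"
  by (simp add: flip_state_def)

lemma prim_sem_IsTup_bitstring: "prim_sem n IsTup (bitstring (replicate k True)) = Bit (k > 0)"
  by (cases k) auto

text \<open>Each round moves one unit from the counter to the list, so \<open>k + length bs\<close>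
  stays constant and one \<open>B\<close> can bound all rounds. Arbitrary \<open>bs\<close> and
  \<open>s\<close> let the induction through.\<close>

lemma exec_flip_loop:
  assumes out: "\<And>k bs. outputs \<O> n p (flip_state (Suc k) bs)
      (map_pmf (\<lambda>b. flip_state k (b # bs)) (bernoulli_pmf (1/2)))"
    and time: "\<And>k bs. k + length bs = m \<Longrightarrow> halts_within \<O> n p (flip_state k bs) B"
    and "k + length bs = m"
  defines "W \<equiv> while_spmf (\<lambda>(y, s). first y = Bit True)
      (\<lambda>(y, s). bind_spmf (exec \<O> n p y) (\<lambda>(z, t). return_spmf (z, s + t + 1)))"
  shows "map_spmf fst (W (flip_state k bs, s)) =
      spmf_of_pmf (map_pmf (\<lambda>cs. flip_state 0 (cs @ bs)) (pmf_of_set {cs. length cs = k})) \<and>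
    (\<forall>(y, t)\<in>set_spmf (W (flip_state k bs, s)). t \<le> s + k * (B + 1))"
  using assms(3)
proof (induction k arbitrary: bs s)
  case 0
  show ?case unfolding W_def by (subst (1 2) while_spmf.simps) (simp add: first_flip_state pmf_of_set_singleton)
next
  case (Suc k)
  have unfold: "W (flip_state (Suc k) bs, s) =
      bind_spmf (exec \<O> n p (flip_state (Suc k) bs)) (\<lambda>(z, t). W (z, s + t + 1))"
    unfolding W_def by (subst while_spmf.simps) (simp add: first_flip_state case_prod_unfold)
  have supp: "\<exists>b. z = flip_state k (b # bs) \<and> t \<le> B"
    if "(z, t) \<in> set_spmf (exec \<O> n p (flip_state (Suc k) bs))" for z t
  proof -
    have "\<exists>b. z = flip_state k (b # bs)"
      using outputs_set[OF out that] by auto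
    moreover have "t \<le> B"
      using time[of "Suc k" bs] Suc.prems that by (auto simp: halts_within_def)
    ultimately show ?thesis by blast
  qed
  have IH: "map_spmf fst (W (flip_state k (b # bs), s)) =
        spmf_of_pmf (map_pmf (\<lambda>cs. flip_state 0 (cs @ b # bs)) (pmf_of_set {cs. length cs = k}))"
      "\<forall>(y, t)\<in>set_spmf (W (flip_state k (b # bs), s)). t \<le> s + k * (B + 1)" for b s
    using Suc.IH[of "b # bs" s] Suc.prems by auto
  let ?E = "\<lambda>z. spmf_of_pmf (map_pmf (\<lambda>cs. flip_state 0 (cs @ z)) (pmf_of_set {cs. length cs = k}))"
  \<comment> \<open>By the induction hypothesis the output distribution does not depend on the
    clock, so the clock may be reset to 0; then \<open>bind_outputs\<close> applies.\<close>
  let ?F = "\<lambda>z. map_spmf fst (W (z, 0))"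
  have "map_spmf fst (W (flip_state (Suc k) bs, s)) =
      bind_spmf (exec \<O> n p (flip_state (Suc k) bs)) (\<lambda>(z, t). ?F z)"
    unfolding unfold map_spmf_bind_spmf using supp IH(1)
    by (intro bind_spmf_cong refl) fastforce
  also have "\<dots> = bind_pmf (bernoulli_pmf (1/2)) (\<lambda>b. ?E (b # bs))"
    unfolding bind_outputs[OF out] using IH(1) by (simp add: bind_map_pmf)
  also have "\<dots> = spmf_of_pmf (map_pmf (\<lambda>cs. flip_state 0 (cs @ bs)) (pmf_of_set {cs. length cs = Suc k}))"
    by (simp add: pmf_of_set_bitlists_Suc map_bind_pmf spmf_of_pmf_bind pmf.map_comp o_def)
  finally have 1: "map_spmf fst (W (flip_state (Suc k) bs, s)) = \<dots>" .
  have "t \<le> s + Suc k * (B + 1)" if "(y, t) \<in> set_spmf (W (flip_state (Suc k) bs, s))" for y t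
  proof -
    from that obtain z u where z: "(z, u) \<in> set_spmf (exec \<O> n p (flip_state (Suc k) bs))"
      and y: "(y, t) \<in> set_spmf (W (z, s + u + 1))"
      unfolding unfold by (auto simp: set_bind_spmf)
    from supp[OF z] y IH(2) have "t \<le> s + u + 1 + k * (B + 1)" "u \<le> B" by fastforce+
    then show ?thesis by simp
  qed
  with 1 show ?case by blast
qed

lemma ppt_random_bits: "ppt (\<lambda>n _. map_pmf bitstring (pmf_of_set {bs. length bs = n}))"
proof -
  \<comment> \<open>One round of the loop: draw a bit, shorten the unary counter, and set the flag
    iff the remaining counter is a tuple, that is, nonzero.\<close>
  have "ppt (\<lambda>n x. bind_pmf (map_pmf Bit (bernoulli_pmf (1/2))) (\<lambda>b. return_pmf
      (prim_sem n IsTup (second (first (second x))) \<diamondop> second (first (second x)) \<diamondop> b \<diamondop> second (second x))))"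
    unfolding ppt_iff_oracle_ppt
    by (intro oracle_ppt_bind oracle_ppt_flip oracle_ppt_tup oracle_ppt_prim[where f=IsTup]
        oracle_ppt_first oracle_ppt_second oracle_ppt_id)
  then obtain p b where
    p: "\<And>\<O> n x. outputs \<O> n p x (bind_pmf (map_pmf Bit (bernoulli_pmf (1/2))) (\<lambda>b. return_pmf
      (prim_sem n IsTup (second (first (second x))) \<diamondop> second (first (second x)) \<diamondop> b \<diamondop> second (second x))))"
    and b: "\<And>\<O> n x. halts_within \<O> n p x (poly b (n + len x))"
    by (rule pptE) (rule that)
  \<comment> \<open>The initial state: \<open>SecParam\<close> is the counter at \<open>n\<close>,
    and \<open>fail\<close> is the empty bit string.\<close>
  have "ppt (\<lambda>n x. return_pmf
      (prim_sem n IsTup (prim_sem n SecParam x) \<diamondop> prim_sem n SecParam x \<diamondop> fail))"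
    unfolding ppt_iff_oracle_ppt
    by (intro oracle_ppt_tup oracle_ppt_prim[where f=IsTup] oracle_ppt_prim[where f=SecParam]
        oracle_ppt_const oracle_ppt_id)
  then have "ppt (\<lambda>n x. return_pmf (flip_state n []))"
    by (simp only: prim_sem.simps(2) prim_sem_IsTup_bitstring flip_state_def bitstring.simps)
  then obtain i c where
    i: "\<And>\<O> n x. outputs \<O> n i x (return_pmf (flip_state n []))"
    and c: "\<And>\<O> n x. halts_within \<O> n i x (poly c (n + len x))"
    by (rule pptE) (rule that)
  have "ppt (\<lambda>n x. return_pmf (second (second x)))"
    unfolding ppt_iff_oracle_ppt by (intro oracle_ppt_second oracle_ppt_id)
  then obtain e d where
    e: "\<And>\<O> n x. outputs \<O> n e x (return_pmf (second (second x)))"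
    and d: "\<And>\<O> n x. halts_within \<O> n e x (poly d (n + len x))"
    by (rule pptE) (rule that)
  let ?p = "SeqP i (SeqP (WhileP p) e)"
  have step: "outputs \<O> n p (flip_state (Suc k) bs)
      (map_pmf (\<lambda>b. flip_state k (b # bs)) (bernoulli_pmf (1/2)))" for \<O> n k bs
    using p[of \<O> n "flip_state (Suc k) bs"]
    by (simp add: flip_state_def prim_sem_IsTup_bitstring bind_map_pmf map_pmf_def bind_return_pmf bind_assoc_pmf
        del: prim_sem.simps)
  have len_state: "len (flip_state k bs) = 2 * (k + length bs) + 5" for k bs
    by (simp add: flip_state_def len_bitstring)
  \<comment> \<open>A state met in the loop has length 2n + 5; adding the security parameter gives
    3n + 5.\<close>
  define B where "B n = poly b (3 * n + 5)" for n
  have bound: "halts_within \<O> n p (flip_state k bs) (B n)" if "k + length bs = n" for \<O> n k bs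
    using b[of \<O> n "flip_state k bs"] that by (simp add: B_def len_state algebra_simps)
  \<comment> \<open>Entering the loop is charged 2n + 5; each of the n rounds costs at most
    \<open>B n\<close>, plus 1.\<close>
  define L where "L n = 2 * n + 5 + n * (B n + 1)" for n
  have while: "outputs \<O> n (WhileP p) (flip_state n [])
      (map_pmf (flip_state 0) (pmf_of_set {cs. length cs = n}))"
    "halts_within \<O> n (WhileP p) (flip_state n []) (L n)" for \<O> n
    using exec_flip_loop[where k=n and bs="[]" and m=n and s="len (flip_state n [])", OF step bound]
    by (auto simp: outputs_def halts_within_def L_def len_state)
  have out: "outputs \<O> n ?p x (map_pmf bitstring (pmf_of_set {bs. length bs = n}))" for \<O> n x
  proof -
    have "outputs \<O> n ?p x (bind_pmf (return_pmf (flip_state n [])) (\<lambda>_.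
        bind_pmf (map_pmf (flip_state 0) (pmf_of_set {cs. length cs = n})) (\<lambda>y. return_pmf (second (second y)))))"
      by (rule outputs_SeqP[OF i]) (use while e in \<open>auto intro: outputs_SeqP\<close>)
    then show ?thesis
      by (simp add: bind_return_pmf bind_assoc_pmf flip_state_def map_pmf_def)
  qed
  have "halts_within \<O> n (SeqP (WhileP p) e) (flip_state n []) (L n + poly d (n + L n) + 1)" for \<O> n
    by (rule halts_within_SeqP[OF while halts_within_mono[OF d]])
       (auto intro!: poly_nat_mono dest!: halts_within_len[OF while] simp del: set_map_pmf)
  then have halts: "halts_within \<O> n ?p x (poly c (n + len x) + (L n + poly d (n + L n) + 1) + 1)" for \<O> n x
    by (intro halts_within_SeqP[OF i c]) simp
  obtain l where l: "\<And>n. L n = poly l n"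
    by (rule that[of "[:5, 2:] + [:0, 1:] * (pcompose b [:5, 3:] + 1)"])
       (simp add: L_def B_def poly_pcompose algebra_simps)
  have "halts_within \<O> n ?p x
      (poly (c + (l + pcompose d ([:0, 1:] + l) + 1) + 1) (n + len x))" for \<O> n x
    by (rule halts_within_mono[OF halts]) (auto simp: poly_pcompose l intro!: add_mono poly_nat_mono)
  with out show ?thesis by (rule pptI[where p="?p"])
qed

section \<open>Adversaries with a simulated oracle\<close>

text \<open>The output of \<open>Q\<close> is taken as the oracle's answer, and the charge is
  computed from it. This supplies the premise on \<open>Q\<close> in
  \<open>rel_spmf_exec_subst_query\<close>.\<close>

lemma rel_spmf_exec_charged:
  assumes out: "outputs \<O> n Q x D"
    and T: "\<And>y s. (y, s) \<in> set_spmf (exec \<O> n Q x) \<Longrightarrow> T s (len x + len y)"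
  shows "rel_spmf (\<lambda>(y, s) (z, t). y = z \<and> T s t) (exec \<O> n Q x) (charged x D)"
proof (rule rel_spmfI)
  let ?J = "map_spmf (\<lambda>(y, s). ((y, s), (y, len x + len y))) (exec \<O> n Q x)"
  show "(\<lambda>(y, s) (z, t). y = z \<and> T s t) u v" if "(u, v) \<in> set_spmf ?J" for u v
    using that T by auto
  show "map_spmf fst ?J = exec \<O> n Q x"
    by (simp add: spmf.map_comp o_def case_prod_unfold)
  have "map_spmf snd ?J = map_spmf (\<lambda>y. (y, len x + len y)) (map_spmf fst (exec \<O> n Q x))"
    by (simp add: spmf.map_comp o_def case_prod_unfold)
  then show "map_spmf snd ?J = charged x D"
    using out by (simp add: outputs_def charged_def)
qed

lemma adv_output_subst_query:
  assumes "\<And>x. outputs \<O> n Q x (\<O>' x)"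
  shows "adv_output \<O> n (subst_query Q A) x = adv_output \<O>' n A x"
proof -
  have "rel_spmf (\<lambda>(y, s) (z, t). y = z \<and> True) (exec \<O> n (subst_query Q A) x) (exec \<O>' n A x)"
    by (rule rel_spmf_exec_subst_query[where T="\<lambda>_ _. True", OF rel_spmf_exec_charged[OF assms]]) simp_all
  then have "rel_spmf (=) (adv_output \<O> n (subst_query Q A) x) (adv_output \<O>' n A x)"
    unfolding adv_output_def spmf_rel_map by (rule rel_spmf_mono) auto
  then show ?thesis by (simp add: spmf_rel_eq)
qed

text \<open>
  The overhead factor of the simulation is a monotone function of the running time \<open>t\<close> of the
  simulated program, which makes the bound \<open>t * (1 + poly c (n + t))\<close> superadditive in \<open>t\<close>.
\<close>

lemma ppt_adversary_subst_query:
  assumes A: "ppt_adversary A"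
    and Q: "\<And>\<O> n x. outputs \<O> n Q x (f \<O> n x)"
    and b: "\<And>q \<O> n x. poly_bounded_oracle q n \<O> \<Longrightarrow> halts_within \<O> n Q x (poly (b q) (n + len x))"
  shows "ppt_adversary (subst_query Q A)"
  unfolding ppt_adversary_def
proof
  fix q
  \<comment> \<open>\<open>c\<close> bounds the time of \<open>Q\<close>, hence the length of the
    answers that \<open>A\<close> receives; the time bound of \<open>A\<close> must be taken for
    oracles bounded by \<open>c\<close>.\<close>
  define c where "c = b q"
  obtain d where d: "\<And>n \<O> x. poly_bounded_oracle c n \<O> \<Longrightarrow> runs_within (exec \<O> n A x) (poly d (n + len x))"
    using A unfolding ppt_adversary_def by blast
  have "runs_within (exec \<O> n (subst_query Q A) x)
      (poly (d * (1 + pcompose c ([:0, 1:] + d))) (n + len x))" if O: "poly_bounded_oracle q n \<O>" for n \<O> x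
  proof -
    have "poly_bounded_oracle c n (f \<O> n)"
      using halts_within_len[OF Q b[OF O]] by (simp add: poly_bounded_oracle_def c_def)
    from d[OF this] have dA: "runs_within (exec (f \<O> n) n A x) (poly d (n + len x))" .
    define T where "T s t \<longleftrightarrow> s \<le> t * (1 + poly c (n + t))" for s t
    have T_add: "T (s + t + 1) (s' + t' + 1)" if "T s s'" "T t t'" for s s' t t'
    proof -
      \<comment> \<open>The factor at the combined time dominates the factors of both parts, and one
        more \<open>?K\<close> pays for the extra unit.\<close>
      let ?K = "1 + poly c (n + (s' + t' + 1))"
      have "s' * (1 + poly c (n + s')) \<le> s' * ?K" "t' * (1 + poly c (n + t')) \<le> t' * ?K"
        by (intro mult_le_mono2 add_mono poly_nat_mono; simp)+
      with that have "s + t + 1 \<le> s' * ?K + t' * ?K + ?K"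
        unfolding T_def by linarith
      then show ?thesis unfolding T_def by (simp only: add_mult_distrib mult_1)
    qed
    have "T s (len y + len z)" if "(z, s) \<in> set_spmf (exec \<O> n Q y)" for y z s
    proof -
      have "s \<le> poly c (n + len y)"
        using b[OF O, of y] that by (auto simp: halts_within_def c_def)
      also have "\<dots> \<le> poly c (n + (len y + len z))"
        by (rule poly_nat_mono) simp
      \<comment> \<open>By \<open>len_pos\<close> the cost of the simulated query is nonzero, so
        multiplying by it only increases the bound.\<close>
      also have "\<dots> \<le> (len y + len z) * (1 + poly c (n + (len y + len z)))"
        using len_pos[of y] by (cases "len y + len z") auto
      finally show ?thesis by (simp add: T_def)
    qed
    then have rel: "rel_spmf (\<lambda>(y, s) (z, t). y = z \<and> T s t)
        (exec \<O> n (subst_query Q A) x) (exec (f \<O> n) n A x)"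
      by (intro rel_spmf_exec_subst_query rel_spmf_exec_charged Q T_add) (auto simp: T_def)
    have "lossless_spmf (exec \<O> n (subst_query Q A) x)"
      using dA rel_spmf_weightD[OF rel] by (simp add: runs_within_def lossless_spmf_def)
    moreover have "s \<le> poly (d * (1 + pcompose c ([:0, 1:] + d))) (n + len x)"
      if "(y, s) \<in> set_spmf (exec \<O> n (subst_query Q A) x)" for y s
    proof -
      \<comment> \<open>The coupling pairs each time of the substituted run with a time of
        \<open>A\<close>, which is at most \<open>poly d (n + len x)\<close>; monotonicity of the
        overhead then gives the polynomial.\<close>
      obtain J where J: "\<And>u v. (u, v) \<in> set_spmf J \<Longrightarrow> (\<lambda>(y, s) (z, t). y = z \<and> T s t) u v"
          "exec \<O> n (subst_query Q A) x = map_spmf fst J" "exec (f \<O> n) n A x = map_spmf snd J"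
        using rel by (rule rel_spmfE) (rule that)
      from that J(2) obtain v where v: "((y, s), v) \<in> set_spmf J"
        by auto
      then have "v \<in> set_spmf (exec (f \<O> n) n A x)"
        unfolding J(3) by force
      then have "snd v \<le> poly d (n + len x)"
        using dA by (auto simp: runs_within_def)
      moreover from J(1)[OF v] have "s \<le> snd v * (1 + poly c (n + snd v))"
        by (auto simp: T_def)
      ultimately have "s \<le> poly d (n + len x) * (1 + poly c (n + len x + poly d (n + len x)))"
        by (elim order_trans) (intro mult_le_mono add_mono poly_nat_mono; simp)
      then show ?thesis by (simp add: poly_pcompose)
    qed
    ultimately show ?thesis by (auto simp: runs_within_def)
  qed
  then show "\<exists>b. \<forall>n \<O> x. poly_bounded_oracle q n \<O> \<longrightarrow>
      runs_within (exec \<O> n (subst_query Q A) x) (poly b (n + len x))"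
    by blast
qed

lemma ppt_adversary_simulate_oracle:
  assumes "ppt_adversary A" "oracle_ppt poly_bounded_oracle f"
  obtains B where "ppt_adversary B" "\<And>\<O> n x. adv_output \<O> n B x = adv_output (f \<O> n) n A x"
proof -
  obtain Q b where Q: "\<And>\<O> n x. outputs \<O> n Q x (f \<O> n x)"
    and b: "\<And>q \<O> n x. poly_bounded_oracle q n \<O> \<Longrightarrow> halts_within \<O> n Q x (poly (b q) (n + len x))"
    using assms(2) by (rule oracle_pptE) (rule that)
  show ?thesis
    using ppt_adversary_subst_query[OF assms(1) Q b] adv_output_subst_query[OF Q] by (rule that)
qed

section \<open>The signing oracle of zkLogin\<close>

text \<open>Projections replace patterns so that the closure rules apply. Malformed tags do no harm:
  the simulated oracle calls this only where the source is defined, and for zkLogin that means tags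
  with four components.\<close>

definition sim_sign ::
    "sig_scheme \<Rightarrow> (nat \<Rightarrow> data \<Rightarrow> data \<Rightarrow> data \<Rightarrow> data pmf) \<Rightarrow> nat \<Rightarrow> data \<Rightarrow> data \<Rightarrow> data \<Rightarrow> data \<Rightarrow> data pmf" where
  "sim_sign S Sim2 n t crs trap m =
     bind_pmf (map_pmf pair_data (sig_gen S n)) (\<lambda>kp.
     bind_pmf (sig_sign S (second kp) m) (\<lambda>\<sigma>.
     bind_pmf (Sim2 n crs trap
       (first t \<diamondop> first (second t) \<diamondop> first (second (second t)) \<diamondop> second (second (second t)) \<diamondop> first kp)) (\<lambda>\<pi>.
     return_pmf (first kp \<diamondop> second (second (second t)) \<diamondop> \<sigma> \<diamondop> \<pi>))))"

lemma ppt_sim_sign: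
  assumes S: "sig_ppt S"
    and Sim2: "ppt (\<lambda>n x. Sim2 n (first x) (first (second x)) (second (second x)))"
  shows "ppt (\<lambda>n x. sim_sign S Sim2 n (first x) (first (second x)) (first (second (second x)))
           (second (second (second x))))"
proof -
  note gen = oracle_ppt_ppt[OF S[unfolded sig_ppt_def, THEN conjunct1]]
  note sign = oracle_ppt_app[OF S[unfolded sig_ppt_def, THEN conjunct2, THEN conjunct1] oracle_ppt_tup, simplified]
  note sim = oracle_ppt_app[OF Sim2 oracle_ppt_tup[OF _ oracle_ppt_tup], simplified]
  show ?thesis
    unfolding ppt_iff_oracle_ppt sim_sign_def
    by (intro oracle_ppt_bind gen sign sim oracle_ppt_tup oracle_ppt_first oracle_ppt_second oracle_ppt_id)
qed

text \<open>The signing oracle with its prover left open as \<open>\<O>\<close>; the honest and the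
  simulated prover give the oracles of the two experiments.\<close>

definition delegated_sign_oracle ::
    "(data \<Rightarrow> data) \<Rightarrow> sig_scheme \<Rightarrow> jwt_scheme \<Rightarrow> environment \<Rightarrow> (data \<Rightarrow> data pmf) \<Rightarrow> nat \<Rightarrow> data \<Rightarrow> data pmf" where
  "delegated_sign_oracle H S J E \<O> n q =
     (case q of
        t \<diamondop> m \<Rightarrow> (case zkLogin_source H S J E n t of
            None \<Rightarrow> return_pmf fail
          | Some D \<Rightarrow> bind_pmf D (\<lambda>w.
              let vk = first (second (second (second w))); sk = second (second (second (second w)));
                  T = second (second (second t)) in
              bind_pmf (sig_sign S sk m) (\<lambda>\<sigma>.
              bind_pmf (\<O> ((first t \<diamondop> first (second t) \<diamondop> first (second (second t)) \<diamondop> T \<diamondop> vk) \<diamondop>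
                first w \<diamondop> first (second w) \<diamondop> first (second (second w)))) (\<lambda>\<pi>.
              return_pmf (vk \<diamondop> T \<diamondop> \<sigma> \<diamondop> \<pi>)))))
      | Bit _ \<Rightarrow> return_pmf fail)"

lemma zkLogin_source_SomeE:
  assumes "zkLogin_source H S J E n t = Some D"
  obtains pk iss zkaddr T sk stid aud salt where
    "t = pk \<diamondop> iss \<diamondop> zkaddr \<diamondop> T" "op_keys E n iss = Some (sk, pk)"
    "owner E n zkaddr = Some (stid, aud, salt)" "zkaddr = H (stid \<diamondop> aud \<diamondop> iss \<diamondop> salt)"
    "D = sample_witness H S J n sk stid aud iss salt T"
  using assms
  by (cases "(H, S, J, E, n, t)" rule: zkLogin_source.cases) (auto split: option.splits if_splits)

lemma sample_witnessE:
  assumes "w \<in> set_pmf (sample_witness H S J n sk stid aud iss salt T)"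
  obtains jwt r vk sk_u where "w = jwt \<diamondop> salt \<diamondop> r \<diamondop> vk \<diamondop> sk_u"
  using assms unfolding sample_witness_def by auto

text \<open>The source yields only well-formed witnesses for well-formed tags, where the projections
  agree with the patterns of \<open>zkLogin_sign\<close>.\<close>

lemma sign_oracle_zkLogin:
  "sign_oracle (zkLogin H S J \<N>) (zkLogin_source H S J E) n crs =
     delegated_sign_oracle H S J E (prove_oracle \<N> n crs) n"
proof
  fix q
  show "sign_oracle (zkLogin H S J \<N>) (zkLogin_source H S J E) n crs q =
     delegated_sign_oracle H S J E (prove_oracle \<N> n crs) n q"
    unfolding sign_oracle_def delegated_sign_oracle_def
    by (auto simp: zkLogin_def prove_oracle_def Let_def split: data.split option.split
        elim!: zkLogin_source_SomeE sample_witnessE intro!: bind_pmf_cong)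
qed

text \<open>Once the membership test of the simulated prover succeeds, the answer depends on the
  witness only through its key pair, which comes from \<open>sig_gen\<close> just as in
  \<open>sim_sign\<close>.\<close>

lemma sim_sign_oracle_zkLogin:
  assumes "sound_source (P_zkLogin H S J) (zkLogin_source H S J E)"
  shows "sim_sign_oracle (sim_sign S Sim2) (zkLogin_source H S J E) n crs trap =
     delegated_sign_oracle H S J E (sim_prove_oracle (Ckt H J) Sim2 n crs trap) n"
proof
  fix q
  show "sim_sign_oracle (sim_sign S Sim2) (zkLogin_source H S J E) n crs trap q =
     delegated_sign_oracle H S J E (sim_prove_oracle (Ckt H J) Sim2 n crs trap) n q"
  proof (cases "\<exists>t m D. q = t \<diamondop> m \<and> zkLogin_source H S J E n t = Some D")
    case False
    then show ?thesis
      unfolding sim_sign_oracle_def delegated_sign_oracle_def by (auto split: data.split option.split)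
  next
    case True
    then obtain t m D where q: "q = t \<diamondop> m" and D: "zkLogin_source H S J E n t = Some D"
      by blast
    from D obtain pk iss zkaddr T sk stid aud salt where t: "t = pk \<diamondop> iss \<diamondop> zkaddr \<diamondop> T"
      and D': "D = sample_witness H S J n sk stid aud iss salt T"
      by (rule zkLogin_source_SomeE)
    let ?sig = "\<lambda>vk sk_u. bind_pmf (sig_sign S sk_u m) (\<lambda>\<sigma>.
        bind_pmf (Sim2 n crs trap (pk \<diamondop> iss \<diamondop> zkaddr \<diamondop> T \<diamondop> vk)) (\<lambda>\<pi>. return_pmf (vk \<diamondop> T \<diamondop> \<sigma> \<diamondop> \<pi>)))"
    have in_Ckt: "(pk \<diamondop> iss \<diamondop> zkaddr \<diamondop> T \<diamondop> first (second (second (second w))),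
        first w \<diamondop> first (second w) \<diamondop> first (second (second w))) \<in> Ckt H J" if "w \<in> set_pmf D" for w
    proof -
      have "P_zkLogin H S J t w"
        using assms D that unfolding sound_source_def by blast
      then show ?thesis by (auto simp: P_zkLogin_def Ckt_def t)
    qed
    have "delegated_sign_oracle H S J E (sim_prove_oracle (Ckt H J) Sim2 n crs trap) n q =
        bind_pmf D (\<lambda>w. ?sig (first (second (second (second w)))) (second (second (second (second w)))))"
      unfolding delegated_sign_oracle_def q
      by (auto simp: D[unfolded t] t Let_def sim_prove_oracle_def in_Ckt
          simp del: zkLogin_source.simps intro!: bind_pmf_cong)
    \<comment> \<open>The randomness \<open>r\<close> and the token integrate out: both have proper
      distributions, and the rest ignores them.\<close>
    also have "\<dots> = bind_pmf (sig_gen S n) (\<lambda>(vk, sk_u). ?sig vk sk_u)"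
      by (simp add: D' sample_witness_def bind_assoc_pmf bind_return_pmf case_prod_unfold)
    also have "\<dots> = sim_sign_oracle (sim_sign S Sim2) (zkLogin_source H S J E) n crs trap q"
      by (simp add: sim_sign_oracle_def q D[unfolded t] sim_sign_def t bind_map_pmf pair_data_def case_prod_unfold
          del: zkLogin_source.simps)
    finally show ?thesis ..
  qed
qed

lemma oracle_ppt_delegated_sign_oracle:
  assumes H: "ppt_fun H" and S: "sig_ppt S" and J: "jwt_ppt J" and E: "environment_ppt E"
  shows "oracle_ppt poly_bounded_oracle (delegated_sign_oracle H S J E)"
proof -
  \<comment> \<open>\<open>K\<close> and \<open>W\<close> are the lookups of the environment as
    data. Their first component is \<open>Bit True\<close> iff the lookup succeeds, since
    \<open>first fail\<close> is \<open>fail\<close>.\<close>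
  define K where "K n iss = (case op_keys E n iss of
      None \<Rightarrow> fail | Some (sk, pk) \<Rightarrow> Bit True \<diamondop> sk \<diamondop> pk)" for n iss
  define W where "W n zkaddr = (case owner E n zkaddr of
      None \<Rightarrow> fail | Some (stid, aud, salt) \<Rightarrow> Bit True \<diamondop> stid \<diamondop> aud \<diamondop> salt)" for n zkaddr
  have "ppt (\<lambda>n iss. return_pmf (K n iss))" "ppt (\<lambda>n zkaddr. return_pmf (W n zkaddr))"
    using E unfolding environment_ppt_def K_def W_def by blast+
  note K = oracle_ppt_app[OF this(1)] and W = oracle_ppt_app[OF this(2)]
  note gen = oracle_ppt_ppt[OF S[unfolded sig_ppt_def, THEN conjunct1]]
  note sign = oracle_ppt_app[OF S[unfolded sig_ppt_def, THEN conjunct2, THEN conjunct1] oracle_ppt_tup, simplified]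
  note issue = oracle_ppt_app[OF J[unfolded jwt_ppt_def, THEN conjunct1] oracle_ppt_tup, simplified]
  note random = oracle_ppt_ppt[OF ppt_random_bits]
  \<comment> \<open>The delegated oracle as a term that the closure rules can compile: projections
    and a single test replace patterns and options, and witness sampling is inlined. The first
    conjunct checks the shape of \<open>q\<close> by rebuilding it; the others say that the source
    is defined at the tag.\<close>
  define G where "G \<O> n q =
      (if q = (first (first q) \<diamondop> first (second (first q)) \<diamondop> first (second (second (first q))) \<diamondop>
             second (second (second (first q)))) \<diamondop> second q \<and>
           first (K n (first (second (first q)))) = Bit True \<and>
           first (W n (first (second (second (first q))))) = Bit True \<and>
           first (first q) = second (second (K n (first (second (first q))))) \<and>
           first (second (second (first q))) =
             H (first (second (W n (first (second (second (first q)))))) \<diamondop>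
                first (second (second (W n (first (second (second (first q))))))) \<diamondop>
                first (second (first q)) \<diamondop>
                second (second (second (W n (first (second (second (first q))))))))
       then
         bind_pmf (map_pmf pair_data (sig_gen S n)) (\<lambda>kp.
         bind_pmf (map_pmf bitstring (pmf_of_set {bs. length bs = n})) (\<lambda>r.
         bind_pmf (jwt_issue J (first (second (K n (first (second (first q))))))
             (first (second (W n (first (second (second (first q)))))) \<diamondop>
              first (second (second (W n (first (second (second (first q))))))) \<diamondop>
              first (second (first q)) \<diamondop>
              H (first kp \<diamondop> second (second (second (first q))) \<diamondop> r))) (\<lambda>jwt.
         bind_pmf (sig_sign S (second kp) (second q)) (\<lambda>\<sigma>.
         bind_pmf (\<O> ((first (first q) \<diamondop> first (second (first q)) \<diamondop> first (second (second (first q))) \<diamondop>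
              second (second (second (first q))) \<diamondop> first kp) \<diamondop>
            jwt \<diamondop> second (second (second (W n (first (second (second (first q))))))) \<diamondop> r)) (\<lambda>\<pi>.
         return_pmf (first kp \<diamondop> second (second (second (first q))) \<diamondop> \<sigma> \<diamondop> \<pi>))))))
       else return_pmf fail)" for \<O> n q
  have "oracle_ppt poly_bounded_oracle G"
    unfolding G_def
    by (intro oracle_ppt_if oracle_ppt_bind oracle_ppt_conj oracle_ppt_eq oracle_ppt_fun[OF H] K W
        gen sign issue random oracle_ppt_query
        oracle_ppt_tup oracle_ppt_first oracle_ppt_second oracle_ppt_id oracle_ppt_const)
  moreover have "G = delegated_sign_oracle H S J E"
  proof (intro ext)
    fix \<O> n q
    show "G \<O> n q = delegated_sign_oracle H S J E \<O> n q"
    proof (cases "\<exists>pk iss zkaddr T m. q = (pk \<diamondop> iss \<diamondop> zkaddr \<diamondop> T) \<diamondop> m")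
      case False
      then have "delegated_sign_oracle H S J E \<O> n q = return_pmf fail"
        unfolding delegated_sign_oracle_def
        by (auto split: data.split option.split elim!: zkLogin_source_SomeE)
      moreover have "G \<O> n q = return_pmf fail"
        using False unfolding G_def by metis
      ultimately show ?thesis by simp
    next
      case True
      then show ?thesis
        by (auto simp: G_def delegated_sign_oracle_def K_def W_def sample_witness_def Let_def
            bind_assoc_pmf bind_return_pmf bind_map_pmf pair_data_def case_prod_unfold
            split: option.splits if_splits)
    qed
  qed
  ultimately show ?thesis by simp
qed

section \<open>Reduction of witness hiding to zero-knowledge\<close>

theorem theorem2:
  fixes H :: "data \<Rightarrow> data" and S :: sig_scheme and J :: jwt_scheme and \<N> :: nizk
  assumes "ppt_fun H" and "sig_ppt S" and "jwt_ppt J" and "nizk_ppt \<N> (Ckt H J)"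
    and "zero_knowledge \<N> (Ckt H J)"
  shows "witness_hiding (P_zkLogin H S J) (zkLogin H S J \<N>) (zkLogin_sources H S J)"
proof -
  obtain Sim1 Sim2 where
    Sim1: "ppt (\<lambda>n _. map_pmf pair_data (Sim1 n))"
    and Sim2: "ppt (\<lambda>n x. Sim2 n (first x) (first (second x)) (second (second x)))"
    and zk: "\<And>B. ppt_adversary B \<Longrightarrow>
      negligible (\<lambda>n. \<bar>spmf (zk_real \<N> (Ckt H J) B n) True - spmf (zk_sim (Ckt H J) Sim1 Sim2 B n) True\<bar>)"
    using assms(5) unfolding zero_knowledge_def by blast
  \<comment> \<open>The simulators depend neither on \<open>A\<close> nor on \<open>W\<close>, as
    the order of quantifiers in \<open>witness_hiding\<close> demands for \<open>W\<close>.\<close>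
  have "negligible (\<lambda>n. \<bar>spmf (expt_real (zkLogin H S J \<N>) W A n) True -
      spmf (expt_sim Sim1 (sim_sign S Sim2) W A n) True\<bar>)"
    if A: "ppt_adversary A" and "W \<in> zkLogin_sources H S J" and sound: "sound_source (P_zkLogin H S J) W" for A W
  proof -
    from that obtain E where W: "W = zkLogin_source H S J E" and E: "environment_ppt E"
      unfolding zkLogin_sources_def by blast
    \<comment> \<open>\<open>B\<close> has the environment built in; this is legitimate because the
      zero-knowledge simulators are fixed before the adversary.\<close>
    obtain B where B: "ppt_adversary B"
      and adv: "\<And>\<O> n x. adv_output \<O> n B x = adv_output (delegated_sign_oracle H S J E \<O> n) n A x"
      using A oracle_ppt_delegated_sign_oracle[OF assms(1-3) E]
      by (rule ppt_adversary_simulate_oracle) (rule that)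
    \<comment> \<open>Both experiments are reproduced exactly for every \<open>n\<close>, so the
      reduction loses nothing.\<close>
    have "expt_real (zkLogin H S J \<N>) W A n = zk_real \<N> (Ckt H J) B n" for n
      by (simp add: expt_real_def zk_real_def adv W sign_oracle_zkLogin) (simp add: zkLogin_def)
    moreover have "expt_sim Sim1 (sim_sign S Sim2) W A n = zk_sim (Ckt H J) Sim1 Sim2 B n" for n
      by (simp add: expt_sim_def zk_sim_def adv W sim_sign_oracle_zkLogin[OF sound[unfolded W]])
    ultimately show ?thesis using zk[OF B] by simp
  qed
  then show ?thesis
    unfolding witness_hiding_def using Sim1 ppt_sim_sign[OF assms(2) Sim2] by blast
qed

end
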